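(* For $i=1,\ldots,4$ let $q_i\ge 2$ and let $F_i$ be an $F(n_i,q_i^{m_i})$ with constant coincidence numbers $\lambda_i$ between its different rows and no fully aliased columns. Let $D_3$ be a normalized difference matrix $\mathrm{ND}(r_3q_3,n_2,q_3)$ defined on an Abelian group $\mathcal{A}_3=\{0,\ldots,q_3-1\}$ without identical rows, and let $D_4$ be a normalized difference matrix $\mathrm{ND}(r_4q_4,n_1,q_4)$ defined on an Abelian group $\mathcal{A}_4=\{0,\ldots,q_4-1\}$ without identical rows. Suppose that (i) $n_1=n_3$ and $n_2=n_4$; (ii) the first rows of $F_3$ and $F_4$ consist of all zeros; (iii) there are no fully aliased columns between $F_3$ and $D_4'$ or between $F_4$ and $D_3'$ (i.e. no column of $F_3$ is fully aliased with a column of $D_4'$, and no column of $F_4$ is fully aliased with a column of $D_3'$). Then $$F=\left[q_2\left(F_1-\frac{q_1-1}{2}\right)\oplus\left(F_2-\frac{q_2-1}{2}\right)+\frac{q_1q_2-1}{2},\; F_3\oplus_{\mathcal{A}_3}D_3',\; D_4'\oplus_{\mathcal{A}_4}F_4\right]$$ is an $F(n_1n_2,(q_1q_2)^{m_1m_2}q_3^{m_3r_3q_3}q_4^{m_4r_4q_4})$ without fully aliased columns, and: (a) if the difference among the three values $\lambda_2m_1+r_3m_3+\lambda_4r_4q_4$, $\lambda_1\lambda_2+r_3m_3+r_4m_4$ and $\lambda_1m_2+\lambda_3r_3q_3+r_4m_4$ does not exceed one (i.e. any two of them differ by at most one), then $F$ is $E(f_{\mathrm{NOD}})$-optimal; (b)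 if $q_1q_2\lambda_2m_1+q_3r_3m_3+\lambda_4r_4q_4^2=q_1q_2\lambda_1\lambda_2+q_3r_3m_3+q_4r_4m_4=q_1q_2\lambda_1m_2+\lambda_3r_3q_3^2+q_4r_4m_4$, then $F$ is $\chi^2$-optimal.
   Context: Prime denotes transpose. An $F(n,q_1\cdots q_m)$ is an $n\times m$ matrix whose $j$th column has entries in $\{0,\ldots,q_j-1\}$ and is balanced (each of the $q_j$ symbols occurs equally often); $F(n,q_1^{r_1}\cdots q_l^{r_l})$ indicates $r_i$ columns with $q_i$ levels. Two columns of equal length are fully aliased if one can be obtained from the other by permuting the levels (columns with different numbers of levels are never fully aliased; a column of $D_i'$ is regarded as having the $q_i$ levels $\{0,\ldots,q_i-1\}$); a design has no fully aliased columns if no two columns in distinct positions are fully aliased. The coincidence number between two rows is the number of columns in which they have the same entry. A difference matrix $D(rq,c,q)$ is an $rq\times c$ array with entries from a finite Abelian group $(\mathcal{A},+)$ with $q$ elements such that each element of $\mathcal{A}$ appears equally often in the vector of differences between any two distinct columns. A difference matrix with $c>1$ is normalized, written $\mathrm{ND}(rq,c,q)$, if its first column consists of all zeros, $0$ being the identity of $\mathcal{A}$. For a scalar $a$ and a matrix $B$, $a+B$ is obtained by adding $a$ to every entry of $B$. For $A=(a_{ij})$, the Kronecker sum $A\oplus B$ (respectively $A\oplus_{\mathcal{A}}B$) is the block matrix whose $(i,j)$ block is obtained by adding $a_{ij}$ to every entry of $B$, with ordinary addition (respectively addition in $\mathcal{A}$). In the first block of $F$, the multiplication by $q_2$ applies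 to $F_1-\frac{q_1-1}{2}$ before the Kronecker sum, and the final constant is added to every entry. For columns $f^i,f^j$ of an $F(n,q_1\cdots q_m)$ put $$f_{\mathrm{NOD}}(f^i,f^j)=\sum_{a=0}^{q_i-1}\sum_{b=0}^{q_j-1}\Big(n_{ab}(f^i,f^j)-\frac{n}{q_iq_j}\Big)^2,$$ where $n_{ab}(f^i,f^j)$ is the number of rows in which $(f^i,f^j)$ equals $(a,b)$. Define $E(f_{\mathrm{NOD}})=\frac{2}{m(m-1)}\sum_{1\le i<j\le m}f_{\mathrm{NOD}}(f^i,f^j)$ and $\chi^2=\sum_{1\le i<j\le m}q_iq_jf_{\mathrm{NOD}}(f^i,f^j)/n$. A design is $E(f_{\mathrm{NOD}})$-optimal (respectively $\chi^2$-optimal) if it minimizes $E(f_{\mathrm{NOD}})$ (respectively $\chi^2$) among all balanced designs with the same number of runs and the same numbers of levels of the columns. *)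

theory Defs
  imports "Jordan_Normal_Form.Matrix" "HOL-Combinatorics.Permutations"
begin

text \<open>
  All arrays are real matrices, because the construction passes through the centred levels
  \<open>x - (q - 1) / 2\<close>. The level set \<open>{0, \<dots>, q - 1}\<close> is therefore a set of real numbers.
  Rows and columns are numbered from 0.
\<close>

definition levels :: "nat \<Rightarrow> real set" where
  "levels q = real ` {..<q}"

text \<open>
  \<open>is_design n qs X\<close>: \<open>X\<close> is an \<open>F(n, q\<^sub>1\<cdots>q\<^sub>m)\<close>, where the list \<open>qs\<close> gives the numbers of
  levels of the columns in order. So \<open>F(n, q\<^sup>m)\<close> is \<open>is_design n (replicate m q)\<close>.
\<close>

definition balanced_col :: "nat \<Rightarrow> real vec \<Rightarrow> bool" where
  "balanced_col q v \<longleftrightarrow>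
     (\<forall>i<dim_vec v. v $ i \<in> levels q) \<and>
     (\<forall>a\<in>levels q. \<forall>b\<in>levels q.
        card {i. i < dim_vec v \<and> v $ i = a} = card {i. i < dim_vec v \<and> v $ i = b})"

definition is_design :: "nat \<Rightarrow> nat list \<Rightarrow> real mat \<Rightarrow> bool" where
  "is_design n qs X \<longleftrightarrow>
     X \<in> carrier_mat n (length qs) \<and> (\<forall>j<length qs. balanced_col (qs ! j) (col X j))"

definition fully_aliased :: "nat \<Rightarrow> real vec \<Rightarrow> nat \<Rightarrow> real vec \<Rightarrow> bool" where
  "fully_aliased p u q v \<longleftrightarrow>
     p = q \<and> (\<exists>\<pi>. \<pi> permutes levels q \<and> v = map_vec \<pi> u)"

definition no_fully_aliased_cols :: "nat list \<Rightarrow> real mat \<Rightarrow> bool" where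
  "no_fully_aliased_cols qs X \<longleftrightarrow>
     (\<forall>i<length qs. \<forall>j<length qs. i \<noteq> j \<longrightarrow>
        \<not> fully_aliased (qs ! i) (col X i) (qs ! j) (col X j))"

text \<open>Here every column of \<open>X\<close> has \<open>p\<close> levels and every column of \<open>Y\<close> has \<open>q\<close> levels.\<close>

definition no_fully_aliased_between :: "nat \<Rightarrow> real mat \<Rightarrow> nat \<Rightarrow> real mat \<Rightarrow> bool" where
  "no_fully_aliased_between p X q Y \<longleftrightarrow>
     (\<forall>i<dim_col X. \<forall>j<dim_col Y. \<not> fully_aliased p (col X i) q (col Y j))"

definition coincidence :: "real mat \<Rightarrow> nat \<Rightarrow> nat \<Rightarrow> nat" where
  "coincidence X i k = card {j. j < dim_col X \<and> X $$ (i, j) = X $$ (k, j)}"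

definition constant_coincidence :: "real mat \<Rightarrow> nat \<Rightarrow> bool" where
  "constant_coincidence X l \<longleftrightarrow>
     (\<forall>i<dim_row X. \<forall>k<dim_row X. i \<noteq> k \<longrightarrow> coincidence X i k = l)"

text \<open>
  The Abelian group is written multiplicatively, as in \<open>HOL-Algebra\<close>: the difference
  of \<open>x\<close> and \<open>y\<close> is \<open>x \<otimes> inv y\<close>, and the zero element is \<open>\<one>\<close>.
\<close>

definition difference_matrix ::
    "real monoid \<Rightarrow> nat \<Rightarrow> nat \<Rightarrow> nat \<Rightarrow> real mat \<Rightarrow> bool" where
  "difference_matrix A r c q D \<longleftrightarrow>
     comm_group A \<and> finite (carrier A) \<and> card (carrier A) = q \<and>
     D \<in> carrier_mat (r * q) c \<and>
     (\<forall>i<r * q. \<forall>j<c. D $$ (i, j) \<in> carrier A) \<and>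
     (\<forall>j<c. \<forall>k<c. j \<noteq> k \<longrightarrow> (\<forall>x\<in>carrier A. \<forall>y\<in>carrier A.
        card {i. i < r * q \<and> D $$ (i, j) \<otimes>\<^bsub>A\<^esub> inv\<^bsub>A\<^esub> (D $$ (i, k)) = x} =
        card {i. i < r * q \<and> D $$ (i, j) \<otimes>\<^bsub>A\<^esub> inv\<^bsub>A\<^esub> (D $$ (i, k)) = y}))"

definition normalized_difference_matrix ::
    "real monoid \<Rightarrow> nat \<Rightarrow> nat \<Rightarrow> nat \<Rightarrow> real mat \<Rightarrow> bool" where
  "normalized_difference_matrix A r c q D \<longleftrightarrow>
     difference_matrix A r c q D \<and> c > 1 \<and> (\<forall>i<r * q. D $$ (i, 0) = \<one>\<^bsub>A\<^esub>)"

text \<open>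
  Kronecker sum with respect to an addition \<open>f\<close>: row \<open>i * dim_row B + k\<close> and column
  \<open>j * dim_col B + l\<close> is position \<open>(k, l)\<close> of block \<open>(i, j)\<close>, with entry
  \<open>f (A $$ (i, j)) (B $$ (k, l))\<close>.
\<close>

definition kron_sum :: "(real \<Rightarrow> real \<Rightarrow> real) \<Rightarrow> real mat \<Rightarrow> real mat \<Rightarrow> real mat" where
  "kron_sum f A B = mat (dim_row A * dim_row B) (dim_col A * dim_col B)
     (\<lambda>(i, j). f (A $$ (i div dim_row B, j div dim_col B))
                 (B $$ (i mod dim_row B, j mod dim_col B)))"

definition add_scalar :: "real \<Rightarrow> real mat \<Rightarrow> real mat" where
  "add_scalar a B = map_mat (\<lambda>x. a + x) B"

definition f_NOD :: "nat \<Rightarrow> real vec \<Rightarrow> nat \<Rightarrow> real vec \<Rightarrow> real" where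
  "f_NOD p u q v = (\<Sum>a\<in>levels p. \<Sum>b\<in>levels q.
     (real (card {k. k < dim_vec u \<and> u $ k = a \<and> v $ k = b})
        - real (dim_vec u) / (real p * real q))\<^sup>2)"

definition E_f_NOD :: "nat list \<Rightarrow> real mat \<Rightarrow> real" where
  "E_f_NOD qs X = 2 / (real (length qs) * (real (length qs) - 1)) *
     (\<Sum>j<length qs. \<Sum>i<j. f_NOD (qs ! i) (col X i) (qs ! j) (col X j))"

definition chi_squared :: "nat list \<Rightarrow> real mat \<Rightarrow> real" where
  "chi_squared qs X = (\<Sum>j<length qs. \<Sum>i<j.
     real (qs ! i) * real (qs ! j) * f_NOD (qs ! i) (col X i) (qs ! j) (col X j)
       / real (dim_row X))"

definition E_f_NOD_optimal :: "nat \<Rightarrow> nat list \<Rightarrow> real mat \<Rightarrow> bool" where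
  "E_f_NOD_optimal n qs X \<longleftrightarrow>
     is_design n qs X \<and> (\<forall>Y. is_design n qs Y \<longrightarrow> E_f_NOD qs X \<le> E_f_NOD qs Y)"

definition chi_squared_optimal :: "nat \<Rightarrow> nat list \<Rightarrow> real mat \<Rightarrow> bool" where
  "chi_squared_optimal n qs X \<longleftrightarrow>
     is_design n qs X \<and> (\<forall>Y. is_design n qs Y \<longrightarrow> chi_squared qs X \<le> chi_squared qs Y)"

end

theory Submission
  imports Defs
begin

text \<open>
  Give column \<open>j\<close> a weight \<open>w\<^sub>j\<close>, and let \<open>c(k, l)\<close> be the total weight of the columns in which
  rows \<open>k\<close> and \<open>l\<close> agree. Counting pairs of rows expresses the sum of \<open>w\<^sub>i w\<^sub>j f\<^sub>N\<^sub>O\<^sub>D\<close> over pairs of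
  columns as half the sum of all \<open>c(k, l)\<^sup>2\<close> plus a term that depends only on the numbers of
  levels, and balance fixes the sum of all \<open>c(k, l)\<close>. So a design is optimal if
  \<open>c(k, l)\<close> is constant off the diagonal, or, when all weights are 1 and \<open>c\<close> is an integer,
  if it only takes two consecutive values. The weights \<open>w\<^sub>j = 1\<close> give (a) and \<open>w\<^sub>j = q\<^sub>j\<close> give (b).

  For the constructed design, \<open>c(k, l)\<close> depends only on whether the two rows agree in
  the first or the second of their Kronecker coordinates. Fully aliased columns induce the same
  partition of the rows. Restricting to the rows where one Kronecker coordinate is 0 reduces
  this to the partitions of the columns of the factors.
\<close>

text \<open>Indicator sums must stay sums: the counting arguments exchange the order of summation,
  which is blocked once they are rewritten into cardinalities.\<close>

declare sum_of_bool_eq [simp del] sum_mult_of_bool_eq [simp del] sum_of_bool_mult_eq [simp del]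

section \<open>Fibres of functions and balanced columns\<close>

lemma card_levels [simp]: "card (levels q) = q"
  by (simp add: levels_def card_image inj_on_def)

lemma finite_levels [simp]: "finite (levels q)"
  by (simp add: levels_def)

lemma card_eq_sum_of_bool:
  "of_nat (card {i. i < (n::nat) \<and> P i}) = (\<Sum>i<n. of_bool (P i) :: 'a::semiring_1)"
proof -
  have "{..<n} \<inter> {i. P i} = {i. i < n \<and> P i}" by auto
  then show ?thesis by (simp add: of_bool_def sum.If_cases)
qed

lemma sum_card_fibres:
  assumes "finite S" "\<And>i. i < n \<Longrightarrow> z i \<in> S"
  shows "(\<Sum>s\<in>S. card {i. i < (n::nat) \<and> z i = s}) = n"
proof -
  have "(\<Sum>s\<in>S. card {i. i < n \<and> z i = s}) = (\<Sum>s\<in>S. \<Sum>i<n. of_bool (z i = s))"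
    using card_eq_sum_of_bool[where 'a = nat] by simp
  also have "\<dots> = (\<Sum>i<n. \<Sum>s\<in>S. of_bool (z i = s))"
    by (rule sum.swap)
  also have "\<dots> = (\<Sum>i<n. 1)"
    using assms by (intro sum.cong refl) (simp add: of_bool_def)
  finally show ?thesis by simp
qed

text \<open>The square of the size of a fibre counts the ordered pairs inside it, and a pair with
  equal images lies in exactly one fibre.\<close>

lemma sum_card_fibres_squared:
  assumes "finite S" "\<And>i. i < n \<Longrightarrow> z i \<in> S"
  shows "(\<Sum>s\<in>S. (real (card {i. i < (n::nat) \<and> z i = s}))\<^sup>2) =
    (\<Sum>k<n. \<Sum>l<n. of_bool (z k = z l))"
proof -
  have "(\<Sum>s\<in>S. (real (card {i. i < n \<and> z i = s}))\<^sup>2) =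
      (\<Sum>s\<in>S. \<Sum>k<n. \<Sum>l<n. of_bool (z k = s) * of_bool (z l = s))"
    by (simp add: card_eq_sum_of_bool power2_eq_square sum_product)
  also have "\<dots> = (\<Sum>k<n. \<Sum>s\<in>S. \<Sum>l<n. of_bool (z k = s) * of_bool (z l = s))"
    by (rule sum.swap)
  also have "\<dots> = (\<Sum>k<n. \<Sum>l<n. \<Sum>s\<in>S. of_bool (z k = s) * of_bool (z l = s))"
    by (intro sum.cong refl sum.swap)
  also have "\<dots> = (\<Sum>k<n. \<Sum>l<n. of_bool (z k = z l))"
  proof (intro sum.cong refl)
    fix k l assume "k \<in> {..<n}" "l \<in> {..<n}"
    have "(\<Sum>s\<in>S. of_bool (z k = s) * of_bool (z l = s)) =
        (\<Sum>s\<in>S. if s = z k then of_bool (z k = z l) else (0::real))"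
      by (intro sum.cong) auto
    then show "(\<Sum>s\<in>S. of_bool (z k = s) * of_bool (z l = s)) = (of_bool (z k = z l) :: real)"
      using assms \<open>k \<in> {..<n}\<close> by simp
  qed
  finally show ?thesis .
qed

lemma equal_fibres_card:
  assumes "finite S" "\<And>i. i < n \<Longrightarrow> z i \<in> S"
    and "\<forall>x\<in>S. \<forall>y\<in>S. card {i. i < n \<and> z i = x} = card {i. i < n \<and> z i = y}"
    and "s \<in> S"
  shows "card S * card {i. i < (n::nat) \<and> z i = s} = n"
proof -
  have "(\<Sum>x\<in>S. card {i. i < n \<and> z i = x}) = (\<Sum>x\<in>S. card {i. i < n \<and> z i = s})"
    by (intro sum.cong refl) (rule assms(3)[rule_format, OF _ assms(4)])
  then show ?thesis
    using sum_card_fibres[OF assms(1,2)] by simp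
qed

lemma balanced_col_levels:
  "balanced_col q v \<Longrightarrow> i < dim_vec v \<Longrightarrow> v $ i \<in> levels q"
  by (simp add: balanced_col_def)

lemma balanced_col_count:
  assumes "balanced_col q v" "a \<in> levels q"
  shows "q * card {i. i < dim_vec v \<and> v $ i = a} = dim_vec v"
  using equal_fibres_card[of "levels q" "dim_vec v" "\<lambda>i. v $ i" a, unfolded card_levels,
      OF finite_levels] assms
  unfolding balanced_col_def by blast

lemma balanced_colI:
  assumes "q > 0" "\<And>i. i < dim_vec v \<Longrightarrow> v $ i \<in> levels q"
    and "\<And>a. a \<in> levels q \<Longrightarrow> q * card {i. i < dim_vec v \<and> v $ i = a} = dim_vec v"
  shows "balanced_col q v"
  unfolding balanced_col_def using assms by (metis mult_left_cancel not_less_zero)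

lemma balanced_col_attains:
  assumes "balanced_col q v" "dim_vec v > 0" "a \<in> levels q"
  shows "\<exists>i<dim_vec v. v $ i = a"
proof -
  have "card {i. i < dim_vec v \<and> v $ i = a} \<noteq> 0"
    using balanced_col_count[OF assms(1,3)] assms(2) by (metis mult_0_right less_irrefl)
  then show ?thesis by (auto simp: card_eq_0_iff)
qed

text \<open>There are \<open>q\<close> fibres of size \<open>n / q\<close>, each with
  \<open>(n / q)^2\<close> ordered pairs. The pairs with \<open>k = l\<close> are included.\<close>

lemma balanced_col_coincidences:
  assumes "balanced_col q v" "q > 0"
  shows "(\<Sum>k<dim_vec v. \<Sum>l<dim_vec v. of_bool (v $ k = v $ l)) = (real (dim_vec v))\<^sup>2 / real q"
proof -
  let ?n = "dim_vec v"
  have "(\<Sum>k<?n. \<Sum>l<?n. of_bool (v $ k = v $ l)) =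
      (\<Sum>a\<in>levels q. (real (card {i. i < ?n \<and> v $ i = a}))\<^sup>2)"
    using assms by (intro sum_card_fibres_squared[symmetric]) (auto simp: balanced_col_levels)
  also have "\<dots> = (\<Sum>a\<in>levels q. (real ?n / real q)\<^sup>2)"
  proof (intro sum.cong refl)
    fix a assume "a \<in> levels q"
    then have "real q * real (card {i. i < ?n \<and> v $ i = a}) = real ?n"
      using balanced_col_count[OF assms(1)] by (metis of_nat_mult)
    then have "real (card {i. i < ?n \<and> v $ i = a}) = real ?n / real q"
      using assms(2) by (simp add: field_simps)
    then show "(real (card {i. i < ?n \<and> v $ i = a}))\<^sup>2 = (real ?n / real q)\<^sup>2"
      by simp
  qed
  also have "\<dots> = (real ?n)\<^sup>2 / real q"
    using assms(2) by (simp add: power2_eq_square field_simps)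
  finally show ?thesis .
qed

section \<open>Non-orthogonality and coincidences\<close>

text \<open>The joint counts are the fibre sizes of the map to pairs of levels. Expanding the square
  around the mean \<open>?e\<close> leaves the sum of squared fibre sizes, the cross term
  \<open>-2 * ?e * n\<close> and \<open>p * q\<close> copies of \<open>?e^2\<close>; the last two
  combine to \<open>-n^2 / (p * q)\<close>.\<close>

lemma f_NOD_coincidences:
  assumes "p > 0" "q > 0" "dim_vec v = dim_vec u"
    and u: "\<And>i. i < dim_vec u \<Longrightarrow> u $ i \<in> levels p"
    and v: "\<And>i. i < dim_vec u \<Longrightarrow> v $ i \<in> levels q"
  shows "f_NOD p u q v =
    (\<Sum>k<dim_vec u. \<Sum>l<dim_vec u. of_bool (u $ k = u $ l) * of_bool (v $ k = v $ l))
      - (real (dim_vec u))\<^sup>2 / (real p * real q)"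
proof -
  let ?n = "dim_vec u"
  let ?S = "levels p \<times> levels q"
  let ?c = "\<lambda>s. real (card {k. k < ?n \<and> (u $ k, v $ k) = s})"
  let ?e = "real ?n / (real p * real q)"
  have S: "\<And>i. i < ?n \<Longrightarrow> (u $ i, v $ i) \<in> ?S" using u v by simp
  have "f_NOD p u q v = (\<Sum>s\<in>?S. (?c s - ?e)\<^sup>2)"
    by (simp add: f_NOD_def sum.cartesian_product split_def prod_eq_iff)
  also have "\<dots> = (\<Sum>s\<in>?S. (?c s)\<^sup>2) - 2 * ?e * (\<Sum>s\<in>?S. ?c s) + (\<Sum>s\<in>?S. ?e\<^sup>2)"
    by (simp add: power2_diff sum.distrib sum_subtractf sum_distrib_left algebra_simps)
  also have "(\<Sum>s\<in>?S. ?c s) = real ?n"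
    using sum_card_fibres[of ?S ?n "\<lambda>k. (u $ k, v $ k)"] S by (simp flip: of_nat_sum)
  also have "(\<Sum>s\<in>?S. ?e\<^sup>2) = real p * real q * ?e\<^sup>2"
    by (simp add: card_cartesian_product)
  also have "(\<Sum>s\<in>?S. (?c s)\<^sup>2) = (\<Sum>k<?n. \<Sum>l<?n. of_bool ((u $ k, v $ k) = (u $ l, v $ l)))"
    by (rule sum_card_fibres_squared) (use S in auto)
  finally show ?thesis
    using assms(1,2) by (simp add: power2_eq_square field_simps of_bool_conj)
qed

definition weighted_coincidence :: "(nat \<Rightarrow> real) \<Rightarrow> real mat \<Rightarrow> nat \<Rightarrow> nat \<Rightarrow> real" where
  "weighted_coincidence w X k l = (\<Sum>j<dim_col X. w j * of_bool (X $$ (k, j) = X $$ (l, j)))"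

definition weighted_f_NOD :: "(nat \<Rightarrow> real) \<Rightarrow> nat list \<Rightarrow> real mat \<Rightarrow> real" where
  "weighted_f_NOD w qs X =
    (\<Sum>j<length qs. \<Sum>i<j. w i * w j * f_NOD (qs ! i) (col X i) (qs ! j) (col X j))"

lemma sum_square_symmetric:
  fixes h :: "nat \<Rightarrow> nat \<Rightarrow> real"
  assumes "\<And>i j. i < m \<Longrightarrow> j < m \<Longrightarrow> h i j = h j i"
  shows "(\<Sum>j<m. \<Sum>i<m. h i j) = 2 * (\<Sum>j<m. \<Sum>i<j. h i j) + (\<Sum>j<m. h j j)"
  using assms
proof (induction m)
  case (Suc m)
  have "(\<Sum>j<m. h m j) = (\<Sum>j<m. h j m)"
    using Suc.prems by (intro sum.cong) auto
  then show ?case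
    using Suc by (simp add: sum.distrib)
qed simp

lemma sum_squared:
  fixes c :: "'a \<Rightarrow> real"
  shows "(\<Sum>j\<in>A. c j)\<^sup>2 = (\<Sum>j\<in>A. \<Sum>i\<in>A. c i * c j)"
  by (simp add: power2_eq_square sum_product mult.commute)

text \<open>Sum over all ordered pairs of columns, the diagonal included, and bring the row sums
  outside: for fixed rows the products of indicators factor into the square of the weighted
  coincidence. Balance makes the diagonal terms explicit, so both subtracted terms are the same for
  all designs with these parameters.\<close>

lemma weighted_f_NOD_coincidences:
  assumes X: "is_design n qs X" and pos: "\<And>j. j < length qs \<Longrightarrow> qs ! j > 0"
  shows "2 * weighted_f_NOD w qs X =
    (\<Sum>k<n. \<Sum>l<n. (weighted_coincidence w X k l)\<^sup>2)
      - (real n)\<^sup>2 * (\<Sum>j<length qs. w j / real (qs ! j))\<^sup>2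
      - (\<Sum>j<length qs. (w j)\<^sup>2 * ((real n)\<^sup>2 / real (qs ! j) - (real n)\<^sup>2 / (real (qs ! j))\<^sup>2))"
proof -
  let ?m = "length qs"
  let ?f = "\<lambda>i j. f_NOD (qs ! i) (col X i) (qs ! j) (col X j)"
  let ?e = "\<lambda>j k l. of_bool (X $$ (k, j) = X $$ (l, j)) :: real"
  have dim [simp]: "dim_row X = n" "dim_col X = ?m" using X by (auto simp: is_design_def)
  have bal: "balanced_col (qs ! j) (col X j)" if "j < ?m" for j
    using X that by (simp add: is_design_def)
  have ent: "X $$ (k, j) \<in> levels (qs ! j)" if "j < ?m" "k < n" for j k
    using balanced_col_levels[OF bal[OF that(1)], of k] that by simp
  have f: "?f i j = (\<Sum>k<n. \<Sum>l<n. ?e i k l * ?e j k l) -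
      (real n)\<^sup>2 / (real (qs ! i) * real (qs ! j))" if "i < ?m" "j < ?m" for i j
    using f_NOD_coincidences[of "qs ! i" "qs ! j" "col X j" "col X i"] pos that ent by simp
  \<comment> \<open>For a column against itself the two indicators coincide, so the double sum is
    the coincidence count of one balanced column.\<close>
  have diag: "?f j j = (real n)\<^sup>2 / real (qs ! j) - (real n)\<^sup>2 / (real (qs ! j))\<^sup>2" if "j < ?m" for j
    using f[OF that that] balanced_col_coincidences[OF bal[OF that] pos[OF that]] that
    by (simp add: power2_eq_square flip: of_bool_conj)
  have "(\<Sum>j<?m. \<Sum>i<?m. w i * w j * ?f i j) =
      (\<Sum>j<?m. \<Sum>i<?m. \<Sum>k<n. \<Sum>l<n. (w i * ?e i k l) * (w j * ?e j k l))
      - (real n)\<^sup>2 * (\<Sum>j<?m. \<Sum>i<?m. (w i / real (qs ! i)) * (w j / real (qs ! j)))"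
    by (simp add: f right_diff_distrib sum_subtractf sum_distrib_left mult_ac)
  also have "(\<Sum>j<?m. \<Sum>i<?m. (w i / real (qs ! i)) * (w j / real (qs ! j))) =
      (\<Sum>j<?m. w j / real (qs ! j))\<^sup>2"
    by (rule sum_squared[symmetric])
  also have "(\<Sum>j<?m. \<Sum>i<?m. \<Sum>k<n. \<Sum>l<n. (w i * ?e i k l) * (w j * ?e j k l)) =
      (\<Sum>k<n. \<Sum>l<n. \<Sum>j<?m. \<Sum>i<?m. (w i * ?e i k l) * (w j * ?e j k l))"
  proof -
    \<comment> \<open>All four sums are exchanged at once by permuting the components of index
      quadruples.\<close>
    have "(\<Sum>j<?m. \<Sum>i<?m. \<Sum>k<n. \<Sum>l<n. h i j k l) = (\<Sum>k<n. \<Sum>l<n. \<Sum>j<?m. \<Sum>i<?m. h i j k l)"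
      for h :: "nat \<Rightarrow> nat \<Rightarrow> nat \<Rightarrow> nat \<Rightarrow> real"
      unfolding sum.cartesian_product
      by (rule sum.reindex_bij_witness[of _ "\<lambda>(k, l, j, i). (j, i, k, l)" "\<lambda>(j, i, k, l). (k, l, j, i)"]) auto
    then show ?thesis .
  qed
  also have "\<dots> = (\<Sum>k<n. \<Sum>l<n. (weighted_coincidence w X k l)\<^sup>2)"
    unfolding weighted_coincidence_def dim sum_squared ..
  \<comment> \<open>This rewrites the left-hand side of the calculation: \<open>f_NOD\<close> is
    symmetric here, so the square of index pairs is two equal triangles and the diagonal.\<close>
  also have "(\<Sum>j<?m. \<Sum>i<?m. w i * w j * ?f i j) =
      2 * weighted_f_NOD w qs X + (\<Sum>j<?m. w j * w j * ?f j j)"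
    unfolding weighted_f_NOD_def
    by (rule sum_square_symmetric) (simp add: f mult_ac)
  also have "(\<Sum>j<?m. w j * w j * ?f j j) =
      (\<Sum>j<?m. (w j)\<^sup>2 * ((real n)\<^sup>2 / real (qs ! j) - (real n)\<^sup>2 / (real (qs ! j))\<^sup>2))"
    by (intro sum.cong) (auto simp: diag power2_eq_square)
  finally show ?thesis by linarith
qed

lemma sum_weighted_coincidence:
  assumes X: "is_design n qs X" and pos: "\<And>j. j < length qs \<Longrightarrow> qs ! j > 0"
  shows "(\<Sum>k<n. \<Sum>l<n. weighted_coincidence w X k l) =
    (\<Sum>j<length qs. w j * ((real n)\<^sup>2 / real (qs ! j)))"
proof -
  let ?m = "length qs"
  let ?e = "\<lambda>j k l. of_bool (X $$ (k, j) = X $$ (l, j)) :: real"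
  have dim [simp]: "dim_row X = n" "dim_col X = ?m" using X by (auto simp: is_design_def)
  have "(\<Sum>k<n. \<Sum>l<n. weighted_coincidence w X k l) = (\<Sum>k<n. \<Sum>j<?m. \<Sum>l<n. w j * ?e j k l)"
    unfolding weighted_coincidence_def by (auto intro!: sum.cong sum.swap)
  also have "\<dots> = (\<Sum>j<?m. \<Sum>k<n. \<Sum>l<n. w j * ?e j k l)"
    by (rule sum.swap)
  also have "\<dots> = (\<Sum>j<?m. w j * (\<Sum>k<n. \<Sum>l<n. ?e j k l))"
    by (simp add: sum_distrib_left)
  also have "\<dots> = (\<Sum>j<?m. w j * ((real n)\<^sup>2 / real (qs ! j)))"
  proof (intro sum.cong refl)
    fix j assume j: "j \<in> {..<?m}"
    then have "balanced_col (qs ! j) (col X j)" using X by (simp add: is_design_def)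
    from balanced_col_coincidences[OF this pos] j
    show "w j * (\<Sum>k<n. \<Sum>l<n. ?e j k l) = w j * ((real n)\<^sup>2 / real (qs ! j))"
      by simp
  qed
  finally show ?thesis .
qed

text \<open>
  The sum of all weighted coincidences is the same for all designs, so minimizing the sum of
  \<open>c\<^sup>2\<close> amounts to minimizing the sum of \<open>(c - s) * (c - t)\<close>.
\<close>

lemma weighted_f_NOD_le:
  assumes X: "is_design n qs X" and Y: "is_design n qs Y"
    and pos: "\<And>j. j < length qs \<Longrightarrow> qs ! j > 0"
    and eqX: "\<And>k l. k < n \<Longrightarrow> l < n \<Longrightarrow> k \<noteq> l \<Longrightarrow>
      (weighted_coincidence w X k l - s) * (weighted_coincidence w X k l - t) = 0"
    and geY: "\<And>k l. k < n \<Longrightarrow> l < n \<Longrightarrow> k \<noteq> l \<Longrightarrow>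
      (weighted_coincidence w Y k l - s) * (weighted_coincidence w Y k l - t) \<ge> 0"
  shows "weighted_f_NOD w qs X \<le> weighted_f_NOD w qs Y"
proof -
  have dim [simp]: "dim_col X = length qs" "dim_col Y = length qs"
    using X Y by (auto simp: is_design_def)
  have diag: "weighted_coincidence w X k k = weighted_coincidence w Y k k" for k
    by (simp add: weighted_coincidence_def)
  \<comment> \<open>Diagonal terms agree, because a row coincides with itself in all columns; off
    the diagonal the terms are zero for \<open>X\<close> and nonnegative for
    \<open>Y\<close>.\<close>
  have "(\<Sum>k<n. \<Sum>l<n. (weighted_coincidence w X k l - s) * (weighted_coincidence w X k l - t)) \<le>
      (\<Sum>k<n. \<Sum>l<n. (weighted_coincidence w Y k l - s) * (weighted_coincidence w Y k l - t))"
    by (intro sum_mono) (metis diag eqX geY lessThan_iff order_refl)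
  moreover have "(\<Sum>k<n. \<Sum>l<n. (weighted_coincidence w Z k l - s) * (weighted_coincidence w Z k l - t)) =
      (\<Sum>k<n. \<Sum>l<n. (weighted_coincidence w Z k l)\<^sup>2)
      - (s + t) * (\<Sum>k<n. \<Sum>l<n. weighted_coincidence w Z k l) + real n * real n * (s * t)" for Z
    by (simp add: sum_distrib_left algebra_simps power2_eq_square sum.distrib sum_subtractf)
  ultimately show ?thesis
    using weighted_f_NOD_coincidences[OF X pos, of w] weighted_f_NOD_coincidences[OF Y pos, of w]
      sum_weighted_coincidence[OF X pos, of w] sum_weighted_coincidence[OF Y pos, of w]
    by simp
qed

text \<open>No integer lies strictly between \<open>t\<close> and \<open>t + 1\<close>, so
  \<open>(c - t) * (c - (t + 1))\<close> is nonnegative at every integer \<open>c\<close> and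
  vanishes at these two values. Unweighted coincidences are integers.\<close>

lemma E_f_NOD_optimalI:
  assumes X: "is_design n qs X" and pos: "\<And>j. j < length qs \<Longrightarrow> qs ! j > 0"
    and t: "\<And>k l. k < n \<Longrightarrow> l < n \<Longrightarrow> k \<noteq> l \<Longrightarrow>
      weighted_coincidence (\<lambda>_. 1) X k l \<in> {real t, real t + 1}"
  shows "E_f_NOD_optimal n qs X"
  unfolding E_f_NOD_optimal_def
proof (intro conjI allI impI X)
  fix Y assume Y: "is_design n qs Y"
  have int: "\<exists>c::int. weighted_coincidence (\<lambda>_. 1) Y k l = of_int c" for k l
  proof
    show "weighted_coincidence (\<lambda>_. 1) Y k l =
      of_int (\<Sum>j<dim_col Y. of_bool (Y $$ (k, j) = Y $$ (l, j)))"
      by (simp add: weighted_coincidence_def)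
  qed
  have ge: "(of_int c - real t) * (of_int c - (real t + 1)) \<ge> 0" for c
  proof (cases "c \<le> int t")
    case True
    then have "of_int c \<le> real t" by linarith
    then show ?thesis by (intro mult_nonpos_nonpos) auto
  next
    case False
    then have "of_int c \<ge> real t + 1" by linarith
    then show ?thesis by (intro mult_nonneg_nonneg) auto
  qed
  have le: "weighted_f_NOD (\<lambda>_. 1) qs X \<le> weighted_f_NOD (\<lambda>_. 1) qs Y"
  proof (rule weighted_f_NOD_le[OF X Y pos, where s = "real t" and t = "real t + 1"])
    show "(weighted_coincidence (\<lambda>_. 1) X k l - real t) *
        (weighted_coincidence (\<lambda>_. 1) X k l - (real t + 1)) = 0"
      if "k < n" "l < n" "k \<noteq> l" for k l
      using t[OF that] by auto
    show "(weighted_coincidence (\<lambda>_. 1) Y k l - real t) *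
        (weighted_coincidence (\<lambda>_. 1) Y k l - (real t + 1)) \<ge> 0" for k l
      using int[of k l] ge by auto
  qed
  have "E_f_NOD qs Z = 2 / (real (length qs) * (real (length qs) - 1)) *
      weighted_f_NOD (\<lambda>_. 1) qs Z" for Z
    by (simp add: E_f_NOD_def weighted_f_NOD_def)
  \<comment> \<open>With fewer than two columns the denominator is 0 and division by zero yields 0,
    so the factor is nonnegative in that case too.\<close>
  moreover have "2 / (real (length qs) * (real (length qs) - 1)) \<ge> 0"
    by (cases "length qs") simp_all
  ultimately show "E_f_NOD qs X \<le> E_f_NOD qs Y"
    by (metis le mult_left_mono)
qed

text \<open>With \<open>s = t\<close> the comparison product is a square, hence nonnegative for
  every competitor, whatever real values its coincidences take.\<close>

lemma chi_squared_optimalI: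
  assumes X: "is_design n qs X" and pos: "\<And>j. j < length qs \<Longrightarrow> qs ! j > 0"
    and t: "\<And>k l. k < n \<Longrightarrow> l < n \<Longrightarrow> k \<noteq> l \<Longrightarrow>
      weighted_coincidence (\<lambda>j. real (qs ! j)) X k l = t"
  shows "chi_squared_optimal n qs X"
  unfolding chi_squared_optimal_def
proof (intro conjI allI impI X)
  fix Y assume Y: "is_design n qs Y"
  have "weighted_f_NOD (\<lambda>j. real (qs ! j)) qs X \<le> weighted_f_NOD (\<lambda>j. real (qs ! j)) qs Y"
  proof (rule weighted_f_NOD_le[OF X Y pos, where s = t and t = t])
    fix k l assume "k < n" "l < n" "k \<noteq> l"
    then show "(weighted_coincidence (\<lambda>j. real (qs ! j)) X k l - t) *
        (weighted_coincidence (\<lambda>j. real (qs ! j)) X k l - t) = 0"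
      by (simp add: t)
  qed simp_all
  moreover have "chi_squared qs Z = weighted_f_NOD (\<lambda>j. real (qs ! j)) qs Z / real n"
    if "is_design n qs Z" for Z
  proof -
    have "dim_row Z = n" using that by (auto simp: is_design_def)
    then show ?thesis
      unfolding chi_squared_def weighted_f_NOD_def sum_divide_distrib by simp
  qed
  ultimately show "chi_squared qs X \<le> chi_squared qs Y"
    using X Y by (simp add: divide_right_mono)
qed

section \<open>Lists of columns labelled with their numbers of levels\<close>

text \<open>Pairing each column with its number of levels keeps \<open>qs\<close> and the matrix in
  step, so juxtaposing blocks becomes appending lists.\<close>

lemma is_design_mat_of_cols:
  assumes "\<And>q v. (q, v) \<in> set L \<Longrightarrow> dim_vec v = N \<and> balanced_col q v"
  shows "is_design N (map fst L) (mat_of_cols N (map snd L))"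
  unfolding is_design_def
proof (intro conjI allI impI)
  show "mat_of_cols N (map snd L) \<in> carrier_mat N (length (map fst L))"
    by (simp add: carrier_matI)
next
  fix j assume "j < length (map fst L)"
  then have j: "j < length L" by simp
  have "dim_vec (snd (L ! j)) = N \<and> balanced_col (fst (L ! j)) (snd (L ! j))"
    using assms[of "fst (L ! j)" "snd (L ! j)"] j by simp
  moreover from this have "col (mat_of_cols N (map snd L)) j = snd (L ! j)"
    using j by (subst col_mat_of_cols) (auto intro: carrier_vecI)
  ultimately show "balanced_col (map fst L ! j) (col (mat_of_cols N (map snd L)) j)"
    using j by simp
qed

lemma fully_aliased_sym:
  assumes "fully_aliased p u q v"
  shows "fully_aliased q v p u"
proof -
  obtain \<pi> where pi: "p = q" "\<pi> permutes levels q" "v = map_vec \<pi> u"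
    using assms by (auto simp: fully_aliased_def)
  then have "u = map_vec (inv_into UNIV \<pi>) v"
    by (auto simp: permutes_inverses)
  then show ?thesis
    using pi permutes_inv unfolding fully_aliased_def by blast
qed

text \<open>\<open>sorted_wrt\<close> compares each entry with the later ones only, which suffices
  because full aliasing is symmetric; it also splits over append into conditions within and between
  blocks.\<close>

lemma no_fully_aliased_mat_of_cols:
  assumes dim: "\<And>q v. (q, v) \<in> set L \<Longrightarrow> dim_vec v = N"
    and L: "sorted_wrt (\<lambda>(p, u) (q, v). \<not> fully_aliased p u q v) L"
  shows "no_fully_aliased_cols (map fst L) (mat_of_cols N (map snd L))"
proof -
  have col: "col (mat_of_cols N (map snd L)) j = snd (L ! j)" if "j < length L" for j
  proof -
    have "dim_vec (snd (L ! j)) = N"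
      using dim[of "fst (L ! j)" "snd (L ! j)"] that by simp
    then show ?thesis
      using that by (subst col_mat_of_cols) (auto intro: carrier_vecI)
  qed
  have "\<not> fully_aliased (fst (L ! i)) (snd (L ! i)) (fst (L ! j)) (snd (L ! j))"
    if "i < j" "j < length L" for i j
    using L that by (auto simp: sorted_wrt_iff_nth_less split_def)
  then have "\<not> fully_aliased (fst (L ! i)) (snd (L ! i)) (fst (L ! j)) (snd (L ! j))"
    if "i \<noteq> j" "i < length L" "j < length L" for i j
    using that fully_aliased_sym by (metis nat_neq_iff)
  then show ?thesis
    by (simp add: no_fully_aliased_cols_def col)
qed

text \<open>The weight is a function \<open>g\<close> of the number of levels, which covers both the
  constant weight 1 and the weight \<open>q\<close>.\<close>

lemma weighted_coincidence_mat_of_cols: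
  assumes "k < N" "l < N"
  shows "weighted_coincidence (\<lambda>j. g (map fst L ! j)) (mat_of_cols N (map snd L)) k l =
    (\<Sum>(q, v)\<leftarrow>L. g q * of_bool (v $ k = v $ l))"
  using assms
  by (simp add: weighted_coincidence_def mat_of_cols_index sum_list_sum_nth split_def
      atLeast0LessThan)

section \<open>Columns of Kronecker sums\<close>

text \<open>The range splits into \<open>a\<close> consecutive intervals of length \<open>b\<close>,
  on each of which the quotient is constant.\<close>

lemma sum_div_mod:
  fixes g :: "nat \<Rightarrow> nat \<Rightarrow> 'a::comm_monoid_add"
  shows "(\<Sum>c<a * b. g (c div b) (c mod b)) = (\<Sum>i<a. \<Sum>k<b. g i k)"
proof -
  have "(\<Sum>i<a. \<Sum>k<b. g i k) = (\<Sum>i<a. \<Sum>c = i * b..<i * b + b. g (c div b) (c mod b))"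
  proof (rule sum.cong[OF refl])
    fix i
    have "(\<Sum>c = i * b..<i * b + b. g (c div b) (c mod b)) =
        (\<Sum>k = 0..<b. g ((k + i * b) div b) ((k + i * b) mod b))"
      using sum.shift_bounds_nat_ivl[of "\<lambda>c. g (c div b) (c mod b)" 0 "i * b" b]
      by (simp add: add.commute)
    then show "(\<Sum>k<b. g i k) = (\<Sum>c = i * b..<i * b + b. g (c div b) (c mod b))"
      by (simp add: atLeast0LessThan)
  qed
  then show ?thesis
    by (simp add: sum.nat_group)
qed

lemma mult_add_less:
  fixes i k a b :: nat
  assumes "i < a" "k < b"
  shows "i * b + k < a * b"
proof -
  have "i * b + k < Suc i * b" using assms by simp
  also have "\<dots> \<le> a * b" using assms by (intro mult_le_mono1) simp
  finally show ?thesis .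
qed

lemma div_mod_less:
  assumes "c < a * (b::nat)"
  shows "c div b < a" "c mod b < b"
  using assms by (auto simp: less_mult_imp_div_less) (metis mod_less_divisor mult_0_right not_less_zero gr0I)

text \<open>The Kronecker sum of two single columns; \<open>f\<close> is later a group operation or
  the mixed radix map.\<close>

definition kron_col :: "(real \<Rightarrow> real \<Rightarrow> real) \<Rightarrow> real vec \<Rightarrow> real vec \<Rightarrow> real vec" where
  "kron_col f u v = vec (dim_vec u * dim_vec v) (\<lambda>R. f (u $ (R div dim_vec v)) (v $ (R mod dim_vec v)))"

lemma dim_kron_col [simp]: "dim_vec (kron_col f u v) = dim_vec u * dim_vec v"
  by (simp add: kron_col_def)

lemma kron_col_index:
  assumes "R < dim_vec u * dim_vec v"
  shows "kron_col f u v $ R = f (u $ (R div dim_vec v)) (v $ (R mod dim_vec v))"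
  using assms by (simp add: kron_col_def)

lemma cols_kron_sum:
  "cols (kron_sum f A B) =
    map (\<lambda>c. kron_col f (col A (c div dim_col B)) (col B (c mod dim_col B))) [0..<dim_col A * dim_col B]"
  unfolding cols_def
proof (rule map_cong)
  show "[0..<dim_col (kron_sum f A B)] = [0..<dim_col A * dim_col B]"
    by (simp add: kron_sum_def)
  fix c assume "c \<in> set [0..<dim_col A * dim_col B]"
  then have "c < dim_col A * dim_col B" by simp
  note c = this div_mod_less[OF this]
  show "col (kron_sum f A B) c = kron_col f (col A (c div dim_col B)) (col B (c mod dim_col B))"
  proof (rule eq_vecI)
    fix R assume "R < dim_vec (kron_col f (col A (c div dim_col B)) (col B (c mod dim_col B)))"
    then have "R < dim_row A * dim_row B" by simp
    note R = this div_mod_less[OF this]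
    show "col (kron_sum f A B) c $ R =
        kron_col f (col A (c div dim_col B)) (col B (c mod dim_col B)) $ R"
      using c R by (simp add: kron_sum_def kron_col_def)
  qed (simp add: kron_sum_def)
qed

lemma in_cols_kron_sum:
  assumes "w \<in> set (cols (kron_sum f A B))"
  obtains j l where "j < dim_col A" "l < dim_col B" "w = kron_col f (col A j) (col B l)"
proof -
  obtain c where c: "c < dim_col A * dim_col B"
    "w = kron_col f (col A (c div dim_col B)) (col B (c mod dim_col B))"
    using assms unfolding cols_kron_sum by auto
  show ?thesis using that[OF div_mod_less[OF c(1)] c(2)] .
qed

text \<open>A column position is recovered from its quotient and remainder, so different positions
  come from different pairs of factor columns.\<close>

lemma sorted_wrt_cols_kron_sum:
  assumes "\<And>j l j' l'. j < dim_col A \<Longrightarrow> j' < dim_col A \<Longrightarrow> l < dim_col B \<Longrightarrow> l' < dim_col B \<Longrightarrow>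
    (j, l) \<noteq> (j', l') \<Longrightarrow> P (kron_col f (col A j) (col B l)) (kron_col f (col A j') (col B l'))"
  shows "sorted_wrt P (cols (kron_sum f A B))"
  unfolding cols_kron_sum sorted_wrt_map
proof (rule sorted_wrt_mono_rel)
  show "sorted_wrt (<) [0..<dim_col A * dim_col B]" by simp
  fix c c' assume c: "c \<in> set [0..<dim_col A * dim_col B]" "c' \<in> set [0..<dim_col A * dim_col B]" "c < c'"
  then have "(c div dim_col B, c mod dim_col B) \<noteq> (c' div dim_col B, c' mod dim_col B)"
    by (metis Pair_inject div_mult_mod_eq less_irrefl)
  then show "P (kron_col f (col A (c div dim_col B)) (col B (c mod dim_col B)))
      (kron_col f (col A (c' div dim_col B)) (col B (c' mod dim_col B)))"
    using c div_mod_less[of c "dim_col A" "dim_col B"] div_mod_less[of c' "dim_col A" "dim_col B"]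
    by (intro assms) simp_all
qed

lemma coincidences_cols_kron_sum:
  assumes "R < dim_row A * dim_row B" "R' < dim_row A * dim_row B"
  shows "(\<Sum>v\<leftarrow>cols (kron_sum f A B). of_bool (v $ R = v $ R')) =
    (\<Sum>j<dim_col A. \<Sum>l<dim_col B.
      of_bool (f (A $$ (R div dim_row B, j)) (B $$ (R mod dim_row B, l)) =
        f (A $$ (R' div dim_row B, j)) (B $$ (R' mod dim_row B, l))) :: nat)"
proof -
  let ?g = "\<lambda>j l. of_bool (f (A $$ (R div dim_row B, j)) (B $$ (R mod dim_row B, l)) =
        f (A $$ (R' div dim_row B, j)) (B $$ (R' mod dim_row B, l))) :: nat"
  have "(\<Sum>v\<leftarrow>cols (kron_sum f A B). of_bool (v $ R = v $ R')) =
      (\<Sum>c<dim_col A * dim_col B. ?g (c div dim_col B) (c mod dim_col B))"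
    unfolding cols_kron_sum sum_list_sum_nth
    using assms by (auto simp: atLeast0LessThan kron_col_index div_mod_less intro!: sum.cong)
  also have "\<dots> = (\<Sum>j<dim_col A. \<Sum>l<dim_col B. ?g j l)"
    by (rule sum_div_mod)
  finally show ?thesis .
qed

lemma balanced_kron_col:
  assumes "q > 0"
    and "\<And>i k. i < dim_vec u \<Longrightarrow> k < dim_vec v \<Longrightarrow> f (u $ i) (v $ k) \<in> levels q"
    and count: "\<And>a. a \<in> levels q \<Longrightarrow>
      q * (\<Sum>i<dim_vec u. \<Sum>k<dim_vec v. of_bool (f (u $ i) (v $ k) = a)) = dim_vec u * dim_vec v"
  shows "balanced_col q (kron_col f u v)"
proof (rule balanced_colI)
  fix i assume "i < dim_vec (kron_col f u v)"
  then show "kron_col f u v $ i \<in> levels q"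
    using assms(2) by (simp add: kron_col_index div_mod_less)
next
  fix a assume a: "a \<in> levels q"
  have "card {R. R < dim_vec (kron_col f u v) \<and> kron_col f u v $ R = a} =
      (\<Sum>R<dim_vec u * dim_vec v. of_bool (f (u $ (R div dim_vec v)) (v $ (R mod dim_vec v)) = a))"
    using card_eq_sum_of_bool[where 'a = nat] by (simp add: kron_col_index)
  then show "q * card {R. R < dim_vec (kron_col f u v) \<and> kron_col f u v $ R = a} = dim_vec (kron_col f u v)"
    using count[OF a] sum_div_mod[of "\<lambda>i k. of_bool (f (u $ i) (v $ k) = a) :: nat" "dim_vec v" "dim_vec u"]
    by simp
qed (fact assms(1))

section \<open>Full aliasing and kernels\<close>

lemma fully_aliased_kernel:
  assumes "fully_aliased p u q v" "i < dim_vec u" "k < dim_vec u"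
  shows "u $ i = u $ k \<longleftrightarrow> v $ i = v $ k"
proof -
  obtain \<pi> where "\<pi> permutes levels q" "v = map_vec \<pi> u"
    using assms by (auto simp: fully_aliased_def)
  then show ?thesis
    using assms permutes_inj[of \<pi> "levels q"] by (auto simp: inj_def)
qed

text \<open>Compares the partitions of the rows in Kronecker coordinates, row
  \<open>i * dim_vec v + k\<close> being \<open>(i, k)\<close>. Later one coordinate is frozen at
  0.\<close>

lemma fully_aliased_kron_col:
  assumes "fully_aliased p (kron_col f u v) q (kron_col g u' v')"
    and "dim_vec u' = dim_vec u" "dim_vec v' = dim_vec v"
    and "i < dim_vec u" "i' < dim_vec u" "k < dim_vec v" "k' < dim_vec v"
  shows "f (u $ i) (v $ k) = f (u $ i') (v $ k') \<longleftrightarrow> g (u' $ i) (v' $ k) = g (u' $ i') (v' $ k')"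
proof -
  have "i * dim_vec v + k < dim_vec u * dim_vec v" "i' * dim_vec v + k' < dim_vec u * dim_vec v"
    using assms by (auto intro: mult_add_less)
  moreover have "dim_vec v \<noteq> 0" using assms by auto
  ultimately show ?thesis
    using fully_aliased_kernel[OF assms(1), of "i * dim_vec v + k" "i' * dim_vec v + k'"] assms
    by (simp add: kron_col_index)
qed

text \<open>A converse of \<open>fully_aliased_kernel\<close>. By balance every level
  \<open>x\<close> occurs in \<open>u\<close>, say in row \<open>s x\<close>; sending
  \<open>x\<close> to the entry of \<open>v\<close> there is independent of the row and injective
  since the kernels agree, and an injective self-map of a finite set is a bijection.\<close>

lemma fully_aliasedI:
  assumes u: "balanced_col p u" and pos: "dim_vec u > 0" and dim: "dim_vec v = dim_vec u"
    and v: "\<And>i. i < dim_vec u \<Longrightarrow> v $ i \<in> levels p"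
    and ker: "\<And>i k. i < dim_vec u \<Longrightarrow> k < dim_vec u \<Longrightarrow> u $ i = u $ k \<longleftrightarrow> v $ i = v $ k"
  shows "fully_aliased p u p v"
proof -
  have "\<forall>x\<in>levels p. \<exists>i<dim_vec u. u $ i = x"
    using balanced_col_attains[OF u pos] by blast
  then obtain s where s: "\<And>x. x \<in> levels p \<Longrightarrow> s x < dim_vec u \<and> u $ s x = x"
    by metis
  \<comment> \<open>The identity outside the level set is what \<open>permutes\<close>
    demands.\<close>
  define \<pi> where "\<pi> x = (if x \<in> levels p then v $ s x else x)" for x
  have "\<pi> ` levels p \<subseteq> levels p"
    using s v by (auto simp: \<pi>_def)
  moreover have "inj_on \<pi> (levels p)"
    unfolding inj_on_def \<pi>_def using s ker by metis
  ultimately have "bij_betw \<pi> (levels p) (levels p)"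
    by (simp add: bij_betw_def endo_inj_surj)
  then have "\<pi> permutes levels p"
    by (rule bij_imp_permutes) (simp add: \<pi>_def)
  moreover have "v = map_vec \<pi> u"
  proof (rule eq_vecI)
    fix i assume "i < dim_vec (map_vec \<pi> u)"
    then have i: "i < dim_vec u" by simp
    then have "u $ i \<in> levels p" using u by (rule balanced_col_levels[rotated])
    then have "s (u $ i) < dim_vec u" "u $ s (u $ i) = u $ i" "\<pi> (u $ i) = v $ s (u $ i)"
      using s by (auto simp: \<pi>_def)
    then show "v $ i = map_vec \<pi> u $ i"
      using ker[of i "s (u $ i)"] i by simp
  qed (simp add: dim)
  ultimately show ?thesis
    by (auto simp: fully_aliased_def)
qed

text \<open>A nonempty balanced column takes all its levels, so the number of levels is the number
  of classes of its kernel.\<close>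

lemma balanced_col_kernel_levels_eq:
  assumes "balanced_col p u" "balanced_col q v" "dim_vec u > 0" "dim_vec v = dim_vec u"
    and ker: "\<And>i k. i < dim_vec u \<Longrightarrow> k < dim_vec u \<Longrightarrow> u $ i = u $ k \<longleftrightarrow> v $ i = v $ k"
  shows "p = q"
proof -
  have image: "(\<lambda>i. w $ i) ` {..<dim_vec w} = levels r"
    if "balanced_col r w" "dim_vec w > 0" for r w
    using balanced_col_attains[OF that] balanced_col_levels[OF that(1)] by force
  have le: "card (f ` S) \<le> card (g ` S)"
    if "finite S" "\<And>i k. i \<in> S \<Longrightarrow> k \<in> S \<Longrightarrow> g i = g k \<Longrightarrow> f i = f k"
    for f g :: "nat \<Rightarrow> real" and S
  proof -
    \<comment> \<open>\<open>f\<close> factors through \<open>g\<close>: evaluating \<open>f\<close>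
      at a chosen preimage of each value of \<open>g\<close> reaches every value of
      \<open>f\<close>.\<close>
    have "f ` S \<subseteq> (\<lambda>y. f (inv_into S g y)) ` g ` S"
    proof
      fix x assume "x \<in> f ` S"
      then obtain i where i: "i \<in> S" "x = f i" by blast
      then have "f (inv_into S g (g i)) = f i"
        by (intro that(2)) (auto simp: f_inv_into_f inv_into_into)
      then show "x \<in> (\<lambda>y. f (inv_into S g y)) ` g ` S"
        using i by (metis imageI)
    qed
    then show ?thesis
      using that(1) by (meson card_image_le card_mono finite_imageI order_trans)
  qed
  have "card (levels p) = card (levels q)"
    using le[of "{..<dim_vec u}" "\<lambda>i. u $ i" "\<lambda>i. v $ i"]
      le[of "{..<dim_vec u}" "\<lambda>i. v $ i" "\<lambda>i. u $ i"] ker image[OF assms(1,3)] image[OF assms(2)]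
      assms(3,4) by (simp add: le_antisym)
  then show ?thesis by simp
qed

section \<open>Translates by a difference matrix\<close>

text \<open>For fixed \<open>k\<close>, translation by \<open>d k\<close> is a bijection of the
  group, so the translated copy of \<open>u\<close> is again balanced. Summing over \<open>k\<close>
  asks nothing of the distribution of \<open>d\<close>.\<close>

lemma count_translates:
  fixes d :: "nat \<Rightarrow> real"
  assumes G: "comm_group G" "carrier G = levels q" and u: "balanced_col q u"
    and d: "\<And>k. k < n \<Longrightarrow> d k \<in> levels q" and a: "a \<in> levels q"
  shows "q * (\<Sum>k<n. \<Sum>i<dim_vec u. of_bool (u $ i \<otimes>\<^bsub>G\<^esub> d k = a)) = dim_vec u * n"
proof -
  interpret comm_group G by fact
  have "q * (\<Sum>k<n. \<Sum>i<dim_vec u. of_bool (u $ i \<otimes>\<^bsub>G\<^esub> d k = a)) =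
      (\<Sum>k<n. q * card {i. i < dim_vec u \<and> u $ i = a \<otimes>\<^bsub>G\<^esub> inv\<^bsub>G\<^esub> d k})"
    unfolding sum_distrib_left[of q] card_eq_sum_of_bool[where 'a = nat, simplified]
  proof (intro sum.cong refl arg_cong[where f = "\<lambda>x. q * x"] arg_cong[where f = of_bool])
    fix k i assume "k \<in> {..<n}" "i \<in> {..<dim_vec u}"
    then have "d k \<in> carrier G" "u $ i \<in> carrier G" "a \<in> carrier G"
      using G d a balanced_col_levels[OF u] by auto
    then show "(u $ i \<otimes>\<^bsub>G\<^esub> d k = a) = (u $ i = a \<otimes>\<^bsub>G\<^esub> inv\<^bsub>G\<^esub> d k)"
      by (metis inv_solve_right)
  qed
  also have "\<dots> = (\<Sum>k<n. dim_vec u)"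
  proof (intro sum.cong refl)
    fix k assume "k \<in> {..<n}"
    then have "a \<otimes>\<^bsub>G\<^esub> inv\<^bsub>G\<^esub> d k \<in> levels q"
      using d a G(2) by (metis inv_closed lessThan_iff m_closed)
    then show "q * card {i. i < dim_vec u \<and> u $ i = a \<otimes>\<^bsub>G\<^esub> inv\<^bsub>G\<^esub> d k} = dim_vec u"
      by (rule balanced_col_count[OF u])
  qed
  finally show ?thesis by (simp add: mult.commute)
qed

text \<open>For \<open>k = k'\<close> the common entry cancels. Otherwise, written additively, the
  equation says that the difference of the entries in columns \<open>k\<close> and \<open>k'\<close>
  is \<open>y - x\<close>, and each of the \<open>q\<close> possible differences occurs in
  \<open>r\<close> of the \<open>r * q\<close> rows.\<close>

lemma difference_matrix_count:
  assumes D: "difference_matrix G r c q D" and "q > 0" "k < c" "k' < c"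
    and xy: "x \<in> carrier G" "y \<in> carrier G"
  shows "(\<Sum>l<r * q. of_bool (x \<otimes>\<^bsub>G\<^esub> D $$ (l, k) = y \<otimes>\<^bsub>G\<^esub> D $$ (l, k'))) =
    (if k = k' then r * q * of_bool (x = y) else r)"
proof -
  interpret comm_group G using D by (simp add: difference_matrix_def)
  have ent: "D $$ (l, j) \<in> carrier G" if "l < r * q" "j < c" for l j
    using D that by (auto simp: difference_matrix_def)
  show ?thesis
  proof (cases "k = k'")
    case True
    then have "(\<Sum>l<r * q. of_bool (x \<otimes>\<^bsub>G\<^esub> D $$ (l, k) = y \<otimes>\<^bsub>G\<^esub> D $$ (l, k'))) =
        (\<Sum>l<r * q. of_bool (x = y) :: nat)"
      using assms ent by (intro sum.cong refl) simp
    then show ?thesis using True by simp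
  next
    case False
    let ?z = "\<lambda>l. D $$ (l, k) \<otimes>\<^bsub>G\<^esub> inv\<^bsub>G\<^esub> (D $$ (l, k'))"
    let ?s = "inv\<^bsub>G\<^esub> x \<otimes>\<^bsub>G\<^esub> y"
    have iff: "(x \<otimes>\<^bsub>G\<^esub> a = y \<otimes>\<^bsub>G\<^esub> b) = (a \<otimes>\<^bsub>G\<^esub> inv\<^bsub>G\<^esub> b = ?s)"
      if "a \<in> carrier G" "b \<in> carrier G" for a b
      using that xy by (metis inv_closed inv_solve_left inv_solve_right m_assoc m_closed)
    have "(\<Sum>l<r * q. of_bool (x \<otimes>\<^bsub>G\<^esub> D $$ (l, k) = y \<otimes>\<^bsub>G\<^esub> D $$ (l, k'))) =
        card {l. l < r * q \<and> ?z l = ?s}"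
      unfolding card_eq_sum_of_bool[where 'a = nat, simplified]
      using ent assms by (intro sum.cong refl) (simp add: iff)
    moreover have "card (carrier G) * card {l. l < r * q \<and> ?z l = ?s} = r * q"
    proof (rule equal_fibres_card)
      show "finite (carrier G)" using D by (simp add: difference_matrix_def)
      show "?z l \<in> carrier G" if "l < r * q" for l
        using ent that assms by simp
      show "\<forall>x\<in>carrier G. \<forall>y\<in>carrier G.
          card {l. l < r * q \<and> ?z l = x} = card {l. l < r * q \<and> ?z l = y}"
        using D False assms(3,4) unfolding difference_matrix_def by blast
      show "?s \<in> carrier G" using xy by simp
    qed
    moreover have "card (carrier G) = q" using D by (simp add: difference_matrix_def)
    ultimately show ?thesis using False \<open>q > 0\<close> by simp
  qed
qed

text \<open>Choose \<open>i\<close> with \<open>x i = d k\<close>. Then positions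
  \<open>(0, k)\<close> and \<open>(i, 0)\<close> carry the same entry, as \<open>x 0\<close> and
  \<open>d 0\<close> are neutral. Carried over to \<open>d'\<close>, the same coincidence reads
  \<open>d' k = x i\<close>.\<close>

lemma translates_kernel_unique:
  fixes x d d' :: "nat \<Rightarrow> real"
  assumes G: "comm_group G"
    and x: "\<And>i. i < n \<Longrightarrow> x i \<in> carrier G" and onto: "\<And>a. a \<in> carrier G \<Longrightarrow> \<exists>i<n. x i = a"
    and x0: "0 < n" "x 0 = \<one>\<^bsub>G\<^esub>"
    and d: "\<And>k. k < m \<Longrightarrow> d k \<in> carrier G" "d 0 = \<one>\<^bsub>G\<^esub>"
    and d': "\<And>k. k < m \<Longrightarrow> d' k \<in> carrier G" "d' 0 = \<one>\<^bsub>G\<^esub>"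
    and ker: "\<And>i i' k k'. i < n \<Longrightarrow> i' < n \<Longrightarrow> k < m \<Longrightarrow> k' < m \<Longrightarrow>
      x i \<otimes>\<^bsub>G\<^esub> d k = x i' \<otimes>\<^bsub>G\<^esub> d k' \<longleftrightarrow> x i \<otimes>\<^bsub>G\<^esub> d' k = x i' \<otimes>\<^bsub>G\<^esub> d' k'"
    and k: "k < m"
  shows "d' k = d k"
proof -
  interpret comm_group G by fact
  obtain i where i: "i < n" "x i = d k" using onto d(1)[OF k] by blast
  have "x 0 \<otimes>\<^bsub>G\<^esub> d k = x i \<otimes>\<^bsub>G\<^esub> d 0"
    using i d k x0 by simp
  then have "x 0 \<otimes>\<^bsub>G\<^esub> d' k = x i \<otimes>\<^bsub>G\<^esub> d' 0"
    using ker[of 0 i k 0] x0 i k by (simp add: gr_implies_not0)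
  then show ?thesis
    using x0 i d' d k by simp
qed

section \<open>Mixed radix levels\<close>

text \<open>Uniqueness of division with remainder by \<open>q\<close>, carried out on the natural
  numbers behind the real levels.\<close>

lemma mixed_radix_eq_iff:
  assumes "x \<in> levels p" "x' \<in> levels p" "y \<in> levels q" "y' \<in> levels q"
  shows "real q * x + y = real q * x' + y' \<longleftrightarrow> x = x' \<and> y = y'"
proof -
  obtain a a' b b' where ab: "x = real a" "x' = real a'" "y = real b" "y' = real b'" "b < q" "b' < q"
    using assms by (auto simp: levels_def)
  have "a = a' \<and> b = b'" if "q * a + b = q * a' + b'"
  proof -
    from that have "(q * a + b) div q = (q * a' + b') div q" "(q * a + b) mod q = (q * a' + b') mod q"
      by simp_all
    then show ?thesis using ab(5,6) by simp
  qed
  then have "real (q * a + b) = real (q * a' + b') \<longleftrightarrow> a = a' \<and> b = b'"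
    using of_nat_eq_iff by blast
  then show ?thesis using ab by simp
qed

lemma mixed_radix_levels:
  assumes "x \<in> levels p" "y \<in> levels q"
  shows "real q * x + y \<in> levels (p * q)"
proof -
  obtain a b where ab: "x = real a" "y = real b" "a < p" "b < q"
    using assms by (auto simp: levels_def)
  then have "real q * x + y = real (a * q + b)" by simp
  then show ?thesis using mult_add_less[OF ab(3,4)] unfolding levels_def by blast
qed

lemma mixed_radix_levels_cases:
  assumes "a \<in> levels (p * q)"
  obtains x y where "x \<in> levels p" "y \<in> levels q" "a = real q * x + y"
proof -
  obtain c where c: "c < p * q" "a = real c"
    using assms by (auto simp: levels_def)
  have "c = q * (c div q) + c mod q" by simp
  then have "real c = real q * real (c div q) + real (c mod q)"
    by (metis of_nat_add of_nat_mult)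
  then show ?thesis
    using that[of "real (c div q)" "real (c mod q)"] div_mod_less[OF c(1)] c(2) by (auto simp: levels_def)
qed

text \<open>Each level has unique digits \<open>x\<close> and \<open>y\<close>, so its frequency is
  the product of their frequencies in \<open>u\<close> and \<open>v\<close>.\<close>

lemma balanced_kron_col_mixed_radix:
  assumes u: "balanced_col p u" and v: "balanced_col q v" and pos: "p > 0" "q > 0"
  shows "balanced_col (p * q) (kron_col (\<lambda>x y. real q * x + y) u v)"
proof (rule balanced_kron_col)
  fix i k assume "i < dim_vec u" "k < dim_vec v"
  then show "real q * u $ i + v $ k \<in> levels (p * q)"
    using u v by (intro mixed_radix_levels balanced_col_levels)
next
  fix a assume "a \<in> levels (p * q)"
  then obtain x y where xy: "x \<in> levels p" "y \<in> levels q" "a = real q * x + y"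
    by (rule mixed_radix_levels_cases)
  have "(\<Sum>i<dim_vec u. \<Sum>k<dim_vec v. of_bool (real q * u $ i + v $ k = a)) =
      (\<Sum>i<dim_vec u. \<Sum>k<dim_vec v. of_bool (u $ i = x) * of_bool (v $ k = y) :: nat)"
    using xy balanced_col_levels[OF u] balanced_col_levels[OF v]
    by (intro sum.cong refl) (simp add: mixed_radix_eq_iff[of _ p _ _ q])
  also have "\<dots> = card {i. i < dim_vec u \<and> u $ i = x} * card {k. k < dim_vec v \<and> v $ k = y}"
    by (simp add: sum_product card_eq_sum_of_bool[where 'a = nat, simplified])
  finally have "p * q * (\<Sum>i<dim_vec u. \<Sum>k<dim_vec v. of_bool (real q * u $ i + v $ k = a)) =
      (p * card {i. i < dim_vec u \<and> u $ i = x}) * (q * card {k. k < dim_vec v \<and> v $ k = y})"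
    by simp
  then show "p * q * (\<Sum>i<dim_vec u. \<Sum>k<dim_vec v. of_bool (real q * u $ i + v $ k = a)) =
      dim_vec u * dim_vec v"
    using balanced_col_count[OF u xy(1)] balanced_col_count[OF v xy(2)] by simp
qed (use pos in simp)

section \<open>The blocks of the construction\<close>

lemma is_design_replicate:
  assumes "is_design n (replicate m q) X"
  shows "dim_row X = n" "dim_col X = m"
    and "j < m \<Longrightarrow> balanced_col q (col X j)"
    and "i < n \<Longrightarrow> j < m \<Longrightarrow> X $$ (i, j) \<in> levels q"
proof -
  show dim: "dim_row X = n" "dim_col X = m"
    using assms by (auto simp: is_design_def)
  show bal: "balanced_col q (col X j)" if "j < m" for j
    using assms that by (auto simp: is_design_def)
  show "X $$ (i, j) \<in> levels q" if "i < n" "j < m"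
    using balanced_col_levels[OF bal[OF that(2)], of i] that dim by simp
qed

lemma coincidence_eq_sum:
  "coincidence X i k = (\<Sum>j<dim_col X. of_bool (X $$ (i, j) = X $$ (k, j)))"
  unfolding coincidence_def using card_eq_sum_of_bool[where 'a = nat] by simp

lemma constant_coincidence_cases:
  assumes "constant_coincidence X l" "i < dim_row X" "k < dim_row X"
  shows "coincidence X i k = (if i = k then dim_col X else l)"
  using assms by (auto simp: constant_coincidence_def coincidence_def)

text \<open>The contrapositive of \<open>fully_aliasedI\<close>: two rows on which the partitions of
  the columns differ.\<close>

lemma no_fully_aliased_cols_kernel:
  assumes X: "is_design n (replicate m q) X" "no_fully_aliased_cols (replicate m q) X" "n > 0"
    and j: "j < m" "j' < m" "j \<noteq> j'"
  shows "\<exists>i<n. \<exists>i'<n. (X $$ (i, j) = X $$ (i', j)) \<noteq> (X $$ (i, j') = X $$ (i', j'))"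
proof (rule ccontr)
  assume "\<not> ?thesis"
  then have "fully_aliased q (col X j) q (col X j')"
    using X(3) j is_design_replicate[OF X(1)] by (intro fully_aliasedI) auto
  then show False
    using X(2) j by (simp add: no_fully_aliased_cols_def)
qed

text \<open>Two entries agree exactly when both digits agree, so the double sum over pairs of
  columns factors.\<close>

lemma coincidences_mixed_radix:
  assumes A: "is_design n1 (replicate m1 p) A" and B: "is_design n2 (replicate m2 q) B"
    and R: "R < n1 * n2" "R' < n1 * n2"
  shows "(\<Sum>v\<leftarrow>cols (kron_sum (\<lambda>x y. real q * x + y) A B). of_bool (v $ R = v $ R')) =
    coincidence A (R div n2) (R' div n2) * coincidence B (R mod n2) (R' mod n2)"
proof -
  note dims = is_design_replicate(1,2)[OF A] is_design_replicate(1,2)[OF B]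
  have "(\<Sum>v\<leftarrow>cols (kron_sum (\<lambda>x y. real q * x + y) A B). of_bool (v $ R = v $ R')) =
      (\<Sum>j<m1. \<Sum>l<m2. of_bool (A $$ (R div n2, j) = A $$ (R' div n2, j)) *
        of_bool (B $$ (R mod n2, l) = B $$ (R' mod n2, l)) :: nat)"
  proof (subst coincidences_cols_kron_sum)
    show "(\<Sum>j<dim_col A. \<Sum>l<dim_col B.
        of_bool (real q * A $$ (R div dim_row B, j) + B $$ (R mod dim_row B, l) =
          real q * A $$ (R' div dim_row B, j) + B $$ (R' mod dim_row B, l))) =
      (\<Sum>j<m1. \<Sum>l<m2. of_bool (A $$ (R div n2, j) = A $$ (R' div n2, j)) *
        of_bool (B $$ (R mod n2, l) = B $$ (R' mod n2, l)) :: nat)"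
      unfolding dims
    proof (rule sum.cong[OF refl], rule sum.cong[OF refl])
      fix j l assume "j \<in> {..<m1}" "l \<in> {..<m2}"
      then show "of_bool (real q * A $$ (R div n2, j) + B $$ (R mod n2, l) =
          real q * A $$ (R' div n2, j) + B $$ (R' mod n2, l)) =
        (of_bool (A $$ (R div n2, j) = A $$ (R' div n2, j)) *
        of_bool (B $$ (R mod n2, l) = B $$ (R' mod n2, l)) :: nat)"
        using div_mod_less[OF R(1)] div_mod_less[OF R(2)]
          is_design_replicate(4)[OF A] is_design_replicate(4)[OF B]
        by (simp add: mixed_radix_eq_iff[of _ p _ _ q])
    qed
  qed (use R dims in auto)
  then show ?thesis
    by (simp add: coincidence_eq_sum dims sum_product)
qed

text \<open>If the columns of \<open>A\<close> differ, freeze the second row coordinate at 0 and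
  separate them by two rows of \<open>A\<close>; otherwise the columns of \<open>B\<close> differ
  and the first coordinate is frozen.\<close>

lemma not_fully_aliased_mixed_radix:
  assumes A: "is_design n1 (replicate m1 p) A" "no_fully_aliased_cols (replicate m1 p) A"
    and B: "is_design n2 (replicate m2 q) B" "no_fully_aliased_cols (replicate m2 q) B"
    and n: "n1 > 0" "n2 > 0"
  shows "sorted_wrt (\<lambda>u v. \<not> fully_aliased s u t v) (cols (kron_sum (\<lambda>x y. real q * x + y) A B))"
proof (rule sorted_wrt_cols_kron_sum, rule notI)
  note dims [simp] = is_design_replicate(1,2)[OF A(1)] is_design_replicate(1,2)[OF B(1)]
  fix j l j' l'
  assume "j < dim_col A" "j' < dim_col A" "l < dim_col B" "l' < dim_col B" and ne: "(j, l) \<noteq> (j', l')"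
    and al: "fully_aliased s (kron_col (\<lambda>x y. real q * x + y) (col A j) (col B l))
      t (kron_col (\<lambda>x y. real q * x + y) (col A j') (col B l'))"
  then have idx: "j < m1" "j' < m1" "l < m2" "l' < m2" by simp_all
  have ker: "(A $$ (i, j) = A $$ (i', j) \<and> B $$ (k, l) = B $$ (k', l)) =
      (A $$ (i, j') = A $$ (i', j') \<and> B $$ (k, l') = B $$ (k', l'))"
    if "i < n1" "i' < n1" "k < n2" "k' < n2" for i i' k k'
    using fully_aliased_kron_col[OF al, of i i' k k'] that idx
      is_design_replicate(4)[OF A(1)] is_design_replicate(4)[OF B(1)]
    by (simp add: mixed_radix_eq_iff[of _ p _ _ q])
  show False
  proof (cases "j = j'")
    case True
    then show False
      using no_fully_aliased_cols_kernel[OF B n(2) idx(3,4)] ne ker[of 0 0] n by auto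
  next
    case False
    then show False
      using no_fully_aliased_cols_kernel[OF A n(1) idx(1,2)] ker[of _ _ 0 0] n by auto
  qed
qed

text \<open>Equal partitions force \<open>s = p\<close>, whereas \<open>q \<ge> 2\<close> makes
  \<open>p * q\<close> larger than \<open>p\<close>. This excludes aliasing of a mixed radix column
  with a translated one.\<close>

lemma fully_aliased_mixed_radix_levels:
  assumes u: "balanced_col p u" "dim_vec u > 0" and "balanced_col s x" "dim_vec x = dim_vec u"
    and ker: "\<And>i i'. i < dim_vec u \<Longrightarrow> i' < dim_vec u \<Longrightarrow> u $ i = u $ i' \<longleftrightarrow> x $ i = x $ i'"
    and "q \<ge> 2" "s > 0"
  shows "s \<noteq> p * q" "s \<noteq> q * p"
  using balanced_col_kernel_levels_eq[OF u(1) assms(3) u(2) assms(4) ker] assms(6,7) by auto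

text \<open>One setting for both group blocks, \<open>F3\<close> with \<open>D3\<close> and
  \<open>F4\<close> with \<open>D4\<close>; they differ in which Kronecker coordinate belongs to
  \<open>X\<close>. The zero row of \<open>X\<close> and the neutral first column of
  \<open>D\<close> let each factor be read off at coordinate 0, and distinct rows of
  \<open>D\<close> are distinct columns of its transpose.\<close>

locale translates =
  fixes G :: "real monoid" and q n m r c :: nat and X D :: "real mat"
  assumes X: "is_design n (replicate m q) X"
    and X_no_alias: "no_fully_aliased_cols (replicate m q) X"
    and X_row0: "row X 0 = 0\<^sub>v m"
    and carrier: "carrier G = levels q" and one: "\<one>\<^bsub>G\<^esub> = 0"
    and D: "normalized_difference_matrix G r c q D" and D_rows: "distinct (rows D)"
    and n_pos: "n > 0" and q_pos: "q > 0"
begin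

sublocale comm_group G
  using D by (simp add: normalized_difference_matrix_def difference_matrix_def)

lemma D_diff: "difference_matrix G r c q D"
  using D by (simp add: normalized_difference_matrix_def)

lemma c_pos: "c > 0"
  using D by (simp add: normalized_difference_matrix_def)

lemma dims [simp]: "dim_row X = n" "dim_col X = m" "dim_row D = r * q" "dim_col D = c"
  using is_design_replicate[OF X] D_diff by (auto simp: difference_matrix_def)

lemma X_carrier: "i < n \<Longrightarrow> j < m \<Longrightarrow> X $$ (i, j) \<in> carrier G"
  using is_design_replicate[OF X] carrier by simp

lemma D_carrier: "l < r * q \<Longrightarrow> k < c \<Longrightarrow> D $$ (l, k) \<in> carrier G"
  using D_diff by (simp add: difference_matrix_def)

lemma X_0: "j < m \<Longrightarrow> X $$ (0, j) = \<one>\<^bsub>G\<^esub>"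
  using arg_cong[OF X_row0, of "\<lambda>v. v $ j"] n_pos one by simp

lemma D_0: "l < r * q \<Longrightarrow> D $$ (l, 0) = \<one>\<^bsub>G\<^esub>"
  using D by (simp add: normalized_difference_matrix_def)

lemma X_attains:
  assumes "j < m" "a \<in> carrier G"
  shows "\<exists>i<n. X $$ (i, j) = a"
  using balanced_col_attains[OF is_design_replicate(3)[OF X assms(1)], of a] assms n_pos carrier
  by fastforce

lemma balanced_translate:
  assumes "j < m" "l < r * q"
  shows "balanced_col q (kron_col (\<lambda>x y. x \<otimes>\<^bsub>G\<^esub> y) (col X j) (col D\<^sup>T l))" (is ?left)
    and "balanced_col q (kron_col (\<lambda>x y. y \<otimes>\<^bsub>G\<^esub> x) (col D\<^sup>T l) (col X j))" (is ?right)
proof -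
  have lev: "X $$ (i, j) \<otimes>\<^bsub>G\<^esub> D $$ (l, k) \<in> levels q" if "i < n" "k < c" for i k
    using m_closed[OF X_carrier[OF that(1) assms(1)] D_carrier[OF assms(2) that(2)]] carrier by simp
  have count: "q * (\<Sum>k<c. \<Sum>i<n. of_bool (X $$ (i, j) \<otimes>\<^bsub>G\<^esub> D $$ (l, k) = a)) = n * c"
    if "a \<in> levels q" for a
    using count_translates[OF comm_group_axioms carrier is_design_replicate(3)[OF X assms(1)],
        of c "\<lambda>k. D $$ (l, k)" a] that D_carrier[OF assms(2)] carrier assms by simp
  have count': "q * (\<Sum>i<n. \<Sum>k<c. of_bool (X $$ (i, j) \<otimes>\<^bsub>G\<^esub> D $$ (l, k) = a)) = n * c"
    if "a \<in> levels q" for a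
    using count[OF that] by (subst sum.swap)
  show ?left
    by (rule balanced_kron_col) (use q_pos lev count' assms in simp_all)
  show ?right
    by (rule balanced_kron_col) (use q_pos lev count assms in \<open>simp_all add: mult.commute\<close>)
qed

text \<open>Apply the difference matrix count to each column of \<open>X\<close>: for equal
  \<open>k\<close> a column contributes all or none of the \<open>r * q\<close> translates, for
  different \<open>k\<close> always \<open>r\<close>.\<close>

lemma translate_coincidences:
  assumes "i < n" "i' < n" "k < c" "k' < c"
  shows "(\<Sum>j<m. \<Sum>l<r * q. of_bool (X $$ (i, j) \<otimes>\<^bsub>G\<^esub> D $$ (l, k) = X $$ (i', j) \<otimes>\<^bsub>G\<^esub> D $$ (l, k'))) =
    (if k = k' then coincidence X i i' * (r * q) else m * r)"
proof -
  have "(\<Sum>j<m. \<Sum>l<r * q. of_bool (X $$ (i, j) \<otimes>\<^bsub>G\<^esub> D $$ (l, k) = X $$ (i', j) \<otimes>\<^bsub>G\<^esub> D $$ (l, k'))) =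
      (\<Sum>j<m. if k = k' then r * q * of_bool (X $$ (i, j) = X $$ (i', j)) else r)"
    using assms by (intro sum.cong[OF refl] difference_matrix_count[OF D_diff q_pos]) (auto simp: X_carrier)
  then show ?thesis
    by (simp add: coincidence_eq_sum sum_distrib_left mult.commute)
qed

lemma coincidences_translates_left:
  assumes "R < n * c" "R' < n * c"
  shows "(\<Sum>v\<leftarrow>cols (kron_sum (\<lambda>x y. x \<otimes>\<^bsub>G\<^esub> y) X D\<^sup>T). of_bool (v $ R = v $ R')) =
    (if R mod c = R' mod c then coincidence X (R div c) (R' div c) * (r * q) else m * r)"
  using assms div_mod_less[OF assms(1)] div_mod_less[OF assms(2)]
  by (simp add: coincidences_cols_kron_sum flip: translate_coincidences)

lemma coincidences_translates_right:
  assumes "R < c * n" "R' < c * n"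
  shows "(\<Sum>v\<leftarrow>cols (kron_sum (\<lambda>x y. y \<otimes>\<^bsub>G\<^esub> x) D\<^sup>T X). of_bool (v $ R = v $ R')) =
    (if R div n = R' div n then coincidence X (R mod n) (R' mod n) * (r * q) else m * r)"
  using assms div_mod_less[OF assms(1)] div_mod_less[OF assms(2)]
  by (simp add: coincidences_cols_kron_sum sum.swap[of _ "{..<m}"] flip: translate_coincidences)

text \<open>At \<open>k = k' = 0\<close> the entries of \<open>D\<close> are neutral, so columns
  \<open>j\<close> and \<open>j'\<close> of \<open>X\<close> have equal partitions and must be the
  same. Then rows \<open>l\<close> and \<open>l'\<close> of \<open>D\<close> agree by
  \<open>translates_kernel_unique\<close>, and the rows of \<open>D\<close> are distinct.\<close>

lemma translates_kernel:
  assumes "j < m" "j' < m" "l < r * q" "l' < r * q"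
    and ker: "\<And>i i' k k'. i < n \<Longrightarrow> i' < n \<Longrightarrow> k < c \<Longrightarrow> k' < c \<Longrightarrow>
      X $$ (i, j) \<otimes>\<^bsub>G\<^esub> D $$ (l, k) = X $$ (i', j) \<otimes>\<^bsub>G\<^esub> D $$ (l, k') \<longleftrightarrow>
      X $$ (i, j') \<otimes>\<^bsub>G\<^esub> D $$ (l', k) = X $$ (i', j') \<otimes>\<^bsub>G\<^esub> D $$ (l', k')"
  shows "j = j' \<and> l = l'"
proof
  show "j = j'"
  proof (rule ccontr)
    assume "j \<noteq> j'"
    then show False
      using no_fully_aliased_cols_kernel[OF X X_no_alias n_pos assms(1,2)] ker[of _ _ 0 0] c_pos
        assms(1-4) by (auto simp: D_0 X_carrier)
  qed
  have "D $$ (l', k) = D $$ (l, k)" if "k < c" for k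
    by (rule translates_kernel_unique[OF comm_group_axioms, where n = n and m = c and
          x = "\<lambda>i. X $$ (i, j)" and d = "\<lambda>k. D $$ (l, k)" and d' = "\<lambda>k. D $$ (l', k)"])
      (use assms that X_attains n_pos ker \<open>j = j'\<close> in \<open>simp_all add: X_carrier D_carrier X_0 D_0\<close>)
  then have "row D l = row D l'"
    using assms by (intro eq_vecI) simp_all
  then show "l = l'"
    using D_rows assms by (auto simp: distinct_conv_nth)
qed

lemma not_fully_aliased_left:
  "sorted_wrt (\<lambda>u v. \<not> fully_aliased s u t v) (cols (kron_sum (\<lambda>x y. x \<otimes>\<^bsub>G\<^esub> y) X D\<^sup>T))"
proof (rule sorted_wrt_cols_kron_sum, rule notI)
  fix j l j' l'
  assume "j < dim_col X" "j' < dim_col X" "l < dim_col D\<^sup>T" "l' < dim_col D\<^sup>T"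
    and ne: "(j, l) \<noteq> (j', l')"
    and al: "fully_aliased s (kron_col (\<lambda>x y. x \<otimes>\<^bsub>G\<^esub> y) (col X j) (col D\<^sup>T l))
      t (kron_col (\<lambda>x y. x \<otimes>\<^bsub>G\<^esub> y) (col X j') (col D\<^sup>T l'))"
  then have "j < m" "j' < m" "l < r * q" "l' < r * q" by simp_all
  then show False
    using translates_kernel[of j j' l l'] fully_aliased_kron_col[OF al] ne by simp
qed

lemma not_fully_aliased_right:
  "sorted_wrt (\<lambda>u v. \<not> fully_aliased s u t v) (cols (kron_sum (\<lambda>x y. y \<otimes>\<^bsub>G\<^esub> x) D\<^sup>T X))"
proof (rule sorted_wrt_cols_kron_sum, rule notI)
  fix l j l' j'
  assume "l < dim_col D\<^sup>T" "l' < dim_col D\<^sup>T" "j < dim_col X" "j' < dim_col X"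
    and ne: "(l, j) \<noteq> (l', j')"
    and al: "fully_aliased s (kron_col (\<lambda>x y. y \<otimes>\<^bsub>G\<^esub> x) (col D\<^sup>T l) (col X j))
      t (kron_col (\<lambda>x y. y \<otimes>\<^bsub>G\<^esub> x) (col D\<^sup>T l') (col X j'))"
  then have "j < m" "j' < m" "l < r * q" "l' < r * q" by simp_all
  then show False
    using translates_kernel[of j j' l l'] fully_aliased_kron_col[OF al] ne by simp
qed

end

section \<open>Assembling the three blocks\<close>

theorem theorem5:
  fixes n1 n2 n3 n4 m1 m2 m3 m4 q1 q2 q3 q4 r3 r4 l1 l2 l3 l4 :: nat
    and F1 F2 F3 F4 D3 D4 F :: "real mat"
    and A3 A4 :: "real monoid"
    and qs :: "nat list"
  assumes "q1 \<ge> 2" "q2 \<ge> 2" "q3 \<ge> 2" "q4 \<ge> 2"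
    and "is_design n1 (replicate m1 q1) F1"
    and "is_design n2 (replicate m2 q2) F2"
    and "is_design n3 (replicate m3 q3) F3"
    and "is_design n4 (replicate m4 q4) F4"
    and "constant_coincidence F1 l1"
    and "constant_coincidence F2 l2"
    and "constant_coincidence F3 l3"
    and "constant_coincidence F4 l4"
    and "no_fully_aliased_cols (replicate m1 q1) F1"
    and "no_fully_aliased_cols (replicate m2 q2) F2"
    and "no_fully_aliased_cols (replicate m3 q3) F3"
    and "no_fully_aliased_cols (replicate m4 q4) F4"
    and "carrier A3 = levels q3" "\<one>\<^bsub>A3\<^esub> = 0"
    and "carrier A4 = levels q4" "\<one>\<^bsub>A4\<^esub> = 0"
    and "normalized_difference_matrix A3 r3 n2 q3 D3" "distinct (rows D3)"
    and "normalized_difference_matrix A4 r4 n1 q4 D4" "distinct (rows D4)"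
    and "n1 = n3" "n2 = n4"
    and "row F3 0 = 0\<^sub>v m3" "row F4 0 = 0\<^sub>v m4"
    and "no_fully_aliased_between q3 F3 q4 (transpose_mat D4)"
    and "no_fully_aliased_between q4 F4 q3 (transpose_mat D3)"
    and F: "F = mat_of_cols (n1 * n2)
      (cols (add_scalar ((real q1 * real q2 - 1) / 2)
         (kron_sum (+) (real q2 \<cdot>\<^sub>m add_scalar (- ((real q1 - 1) / 2)) F1)
                       (add_scalar (- ((real q2 - 1) / 2)) F2))) @
       cols (kron_sum (\<lambda>x y. x \<otimes>\<^bsub>A3\<^esub> y) F3 (transpose_mat D3)) @
       cols (kron_sum (\<lambda>x y. x \<otimes>\<^bsub>A4\<^esub> y) (transpose_mat D4) F4))"
    and qs: "qs = replicate (m1 * m2) (q1 * q2) @ replicate (m3 * r3 * q3) q3 @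
                  replicate (m4 * r4 * q4) q4"
  shows "is_design (n1 * n2) qs F \<and> no_fully_aliased_cols qs F \<and>
    ((\<forall>x \<in> {l2 * m1 + r3 * m3 + l4 * r4 * q4,
             l1 * l2 + r3 * m3 + r4 * m4,
             l1 * m2 + l3 * r3 * q3 + r4 * m4}.
      \<forall>y \<in> {l2 * m1 + r3 * m3 + l4 * r4 * q4,
             l1 * l2 + r3 * m3 + r4 * m4,
             l1 * m2 + l3 * r3 * q3 + r4 * m4}. \<bar>int x - int y\<bar> \<le> 1)
       \<longrightarrow> E_f_NOD_optimal (n1 * n2) qs F) \<and>
    (q1 * q2 * l2 * m1 + q3 * r3 * m3 + l4 * r4 * q4\<^sup>2
        = q1 * q2 * l1 * l2 + q3 * r3 * m3 + q4 * r4 * m4 \<and>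
     q1 * q2 * l1 * l2 + q3 * r3 * m3 + q4 * r4 * m4
        = q1 * q2 * l1 * m2 + l3 * r3 * q3\<^sup>2 + q4 * r4 * m4
       \<longrightarrow> chi_squared_optimal (n1 * n2) qs F)"
proof -
  note q = assms(1-4) and F1 = assms(5) and F2 = assms(6) and F3 = assms(7) and F4 = assms(8)
    and coinc = assms(9-12) and alias1 = assms(13) and alias2 = assms(14)
    and alias34 = assms(29)
  have n34: "n3 = n1" "n4 = n2" using assms(25,26) by simp_all
  \<comment> \<open>A normalized difference matrix has more than one column, and \<open>n2\<close>
    and \<open>n1\<close> are the numbers of columns of \<open>D3\<close> and
    \<open>D4\<close>.\<close>
  have n: "n1 > 0" "n2 > 0"
    using assms(21,23) by (auto simp: normalized_difference_matrix_def)
  interpret t3: translates A3 q3 n1 m3 r3 n2 F3 D3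
    by unfold_locales (use assms n in auto)
  interpret t4: translates A4 q4 n2 m4 r4 n1 F4 D4
    by unfold_locales (use assms n in auto)
  note dims [simp] = is_design_replicate(1,2)[OF F1] is_design_replicate(1,2)[OF F2]
  let ?mix = "\<lambda>x y. real q2 * x + y"
  let ?op3 = "\<lambda>x y. x \<otimes>\<^bsub>A3\<^esub> y"
  \<comment> \<open>The operands are swapped so that the entry of \<open>F4\<close> comes first, as
    in the locale; \<open>block3\<close> justifies this by commutativity.\<close>
  let ?op4 = "\<lambda>x y. y \<otimes>\<^bsub>A4\<^esub> x"
  define B1 where "B1 = cols (kron_sum ?mix F1 F2)"
  define B2 where "B2 = cols (kron_sum ?op3 F3 D3\<^sup>T)"
  define B3 where "B3 = cols (kron_sum ?op4 D4\<^sup>T F4)"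
  define L where "L = map (Pair (q1 * q2)) B1 @ map (Pair q3) B2 @ map (Pair q4) B3"
  \<comment> \<open>The centring constants cancel, since
    \<open>q2 * (q1 - 1) / 2 + (q2 - 1) / 2 = (q1 * q2 - 1) / 2\<close>.\<close>
  have block1: "add_scalar ((real q1 * real q2 - 1) / 2)
      (kron_sum (+) (real q2 \<cdot>\<^sub>m add_scalar (- ((real q1 - 1) / 2)) F1)
        (add_scalar (- ((real q2 - 1) / 2)) F2)) = kron_sum ?mix F1 F2" (is "?lhs = _")
  proof (rule eq_matI)
    fix i j assume "i < dim_row (kron_sum ?mix F1 F2)" "j < dim_col (kron_sum ?mix F1 F2)"
    then have "i < n1 * n2" "j < m1 * m2" by (simp_all add: kron_sum_def)
    note ij = this div_mod_less[OF this(1)] div_mod_less[OF this(2)]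
    show "?lhs $$ (i, j) = kron_sum ?mix F1 F2 $$ (i, j)"
      using ij by (simp add: kron_sum_def add_scalar_def field_simps)
  qed (simp_all add: kron_sum_def add_scalar_def)
  have block3: "kron_sum (\<lambda>x y. x \<otimes>\<^bsub>A4\<^esub> y) D4\<^sup>T F4 = kron_sum ?op4 D4\<^sup>T F4"
  proof (rule eq_matI)
    fix i j assume "i < dim_row (kron_sum ?op4 D4\<^sup>T F4)" "j < dim_col (kron_sum ?op4 D4\<^sup>T F4)"
    then have "i < n1 * n2" "j < (r4 * q4) * m4" by (simp_all add: kron_sum_def)
    note ij = this div_mod_less[OF this(1)] div_mod_less[OF this(2)]
    show "kron_sum (\<lambda>x y. x \<otimes>\<^bsub>A4\<^esub> y) D4\<^sup>T F4 $$ (i, j) = kron_sum ?op4 D4\<^sup>T F4 $$ (i, j)"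
      using ij t4.m_comm[OF t4.D_carrier t4.X_carrier] by (simp add: kron_sum_def)
  qed (simp_all add: kron_sum_def)
  have F_L: "F = mat_of_cols (n1 * n2) (map snd L)"
    unfolding F block1 block3 by (simp add: L_def B1_def B2_def B3_def comp_def)
  have qs_L: "qs = map fst L"
    unfolding qs by (simp add: L_def B1_def B2_def B3_def comp_def map_replicate_const kron_sum_def mult_ac)
  have L_cases: "(p = q1 * q2 \<and> (\<exists>j<m1. \<exists>l<m2. v = kron_col ?mix (col F1 j) (col F2 l))) \<or>
      (p = q3 \<and> (\<exists>j<m3. \<exists>l<r3 * q3. v = kron_col ?op3 (col F3 j) (col D3\<^sup>T l))) \<or>
      (p = q4 \<and> (\<exists>l<r4 * q4. \<exists>j<m4. v = kron_col ?op4 (col D4\<^sup>T l) (col F4 j)))"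
    if pv: "(p, v) \<in> set L" for p v
  proof -
    consider "p = q1 * q2" "v \<in> set B1" | "p = q3" "v \<in> set B2" | "p = q4" "v \<in> set B3"
      using pv by (auto simp: L_def)
    then show ?thesis
      unfolding B1_def B2_def B3_def by cases (fastforce elim: in_cols_kron_sum)+
  qed
  have bal: "dim_vec v = n1 * n2 \<and> balanced_col p v" if "(p, v) \<in> set L" for p v
    using L_cases[OF that] t3.balanced_translate(1) t4.balanced_translate(2) q
      balanced_kron_col_mixed_radix[OF is_design_replicate(3)[OF F1] is_design_replicate(3)[OF F2]]
    by auto
  have design: "is_design (n1 * n2) qs F"
    unfolding F_L qs_L by (rule is_design_mat_of_cols) (rule bal)
  have pos: "qs ! j > 0" if "j < length qs" for j
  proof -
    have "qs ! j \<in> set qs" using that by simp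
    then show ?thesis using q unfolding qs by auto
  qed

  have alias12: "\<not> fully_aliased (q1 * q2) u q3 v" if uv: "u \<in> set B1" "v \<in> set B2" for u v
  proof
    assume al: "fully_aliased (q1 * q2) u q3 v"
    obtain j l where u: "j < m1" "l < m2" "u = kron_col ?mix (col F1 j) (col F2 l)"
      using uv(1) unfolding B1_def by (auto elim: in_cols_kron_sum)
    obtain j' l' where v: "j' < m3" "l' < r3 * q3" "v = kron_col ?op3 (col F3 j') (col D3\<^sup>T l')"
      using uv(2) unfolding B2_def by (auto elim: in_cols_kron_sum)
    \<comment> \<open>With the second coordinate at 0, \<open>D3\<close> contributes its neutral
      first column, which leaves the bare column of \<open>F3\<close>.\<close>
    have ker: "F1 $$ (i, j) = F1 $$ (i', j) \<longleftrightarrow> F3 $$ (i, j') = F3 $$ (i', j')"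
      if "i < n1" "i' < n1" for i i'
      using fully_aliased_kron_col[OF al[unfolded u v], of i i' 0 0] that n u v q
      by (simp add: t3.D_0 t3.X_carrier)
    show False
      using fully_aliased_mixed_radix_levels(1)[OF is_design_replicate(3)[OF F1 u(1)] _
          is_design_replicate(3)[OF t3.X v(1)], of q2] ker n q u v al
      by (auto simp: fully_aliased_def)
  qed
  have alias13: "\<not> fully_aliased (q1 * q2) u q4 v" if uv: "u \<in> set B1" "v \<in> set B3" for u v
  proof
    assume al: "fully_aliased (q1 * q2) u q4 v"
    obtain j l where u: "j < m1" "l < m2" "u = kron_col ?mix (col F1 j) (col F2 l)"
      using uv(1) unfolding B1_def by (auto elim: in_cols_kron_sum)
    obtain l' j' where v: "l' < r4 * q4" "j' < m4" "v = kron_col ?op4 (col D4\<^sup>T l') (col F4 j')"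
      using uv(2) unfolding B3_def by (auto elim: in_cols_kron_sum)
    \<comment> \<open>Here the first coordinate is 0, and the neutral first column of
      \<open>D4\<close> leaves the bare column of \<open>F4\<close>.\<close>
    have ker: "F2 $$ (i, l) = F2 $$ (i', l) \<longleftrightarrow> F4 $$ (i, j') = F4 $$ (i', j')"
      if "i < n2" "i' < n2" for i i'
      using fully_aliased_kron_col[OF al[unfolded u v], of 0 0 i i'] that n u v q
      by (simp add: t4.D_0 t4.X_carrier)
    show False
      using fully_aliased_mixed_radix_levels(2)[OF is_design_replicate(3)[OF F2 u(2)] _
          is_design_replicate(3)[OF t4.X v(2)], of q1] ker n q u v al
      by (auto simp: fully_aliased_def)
  qed
  have alias23: "\<not> fully_aliased q3 u q4 v" if uv: "u \<in> set B2" "v \<in> set B3" for u v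
  proof
    assume al: "fully_aliased q3 u q4 v"
    obtain j l where u: "j < m3" "l < r3 * q3" "u = kron_col ?op3 (col F3 j) (col D3\<^sup>T l)"
      using uv(1) unfolding B2_def by (auto elim: in_cols_kron_sum)
    obtain l' j' where v: "l' < r4 * q4" "j' < m4" "v = kron_col ?op4 (col D4\<^sup>T l') (col F4 j')"
      using uv(2) unfolding B3_def by (auto elim: in_cols_kron_sum)
    have q34: "q3 = q4" using al by (simp add: fully_aliased_def)
    \<comment> \<open>With the second coordinate at 0, the neutral first column of \<open>D3\<close>
      leaves a column of \<open>F3\<close> and the zero first row of \<open>F4\<close> leaves a
      column of the transpose of \<open>D4\<close>. Hypothesis (iii) forbids aliasing between
      these.\<close>
    have ker: "F3 $$ (i, j) = F3 $$ (i', j) \<longleftrightarrow> D4 $$ (l', i) = D4 $$ (l', i')"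
      if "i < n1" "i' < n1" for i i'
      using fully_aliased_kron_col[OF al[unfolded u v], of i i' 0 0] that n u v
      by (simp add: t3.D_0 t3.X_carrier t4.X_0 t4.D_carrier)
    have "fully_aliased q3 (col F3 j) q3 (col D4\<^sup>T l')"
      using n u v ker t4.D_carrier t4.carrier q34
      by (intro fully_aliasedI is_design_replicate(3)[OF t3.X]) auto
    then show False
      using alias34 u(1) v(1) q34 by (auto simp: no_fully_aliased_between_def)
  qed
  have "sorted_wrt (\<lambda>(p, u) (q, v). \<not> fully_aliased p u q v) L"
    unfolding L_def sorted_wrt_append sorted_wrt_map
    using alias12 alias13 alias23 not_fully_aliased_mixed_radix[OF F1 alias1 F2 alias2 n]
      t3.not_fully_aliased_left t4.not_fully_aliased_right
    by (auto simp: B1_def B2_def B3_def)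
  then have no_alias: "no_fully_aliased_cols qs F"
    unfolding F_L qs_L using bal by (intro no_fully_aliased_mat_of_cols) auto

  \<comment> \<open>Each triple lists the coincidences in the three blocks. In order, the rows agree
    in the first Kronecker coordinate only, in neither, or in the second only. The weight
    \<open>g\<close> is left general to serve both criteria.\<close>
  have wc: "\<exists>x\<in>{(l2 * m1, r3 * m3, l4 * r4 * q4), (l1 * l2, r3 * m3, r4 * m4),
        (l1 * m2, l3 * r3 * q3, r4 * m4)}.
      weighted_coincidence (\<lambda>j. g (qs ! j)) F R R' =
        g (q1 * q2) * real (fst x) + g q3 * real (fst (snd x)) + g q4 * real (snd (snd x))"
    if R: "R < n1 * n2" "R' < n1 * n2" "R \<noteq> R'" for R R' g
  proof -
    let ?c = "\<lambda>B. (\<Sum>v\<leftarrow>B. of_bool (v $ R = v $ R') :: nat)"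
    have sum: "(\<Sum>v\<leftarrow>B. a * of_bool (v $ R = v $ R')) = a * real (?c B)" for a B
      by (induction B) (simp_all add: algebra_simps)
    have "weighted_coincidence (\<lambda>j. g (qs ! j)) F R R' =
        g (q1 * q2) * real (?c B1) + g q3 * real (?c B2) + g q4 * real (?c B3)"
      unfolding F_L qs_L weighted_coincidence_mat_of_cols[OF R(1,2)]
      by (simp add: L_def comp_def sum)
    moreover have "R div n2 \<noteq> R' div n2 \<or> R mod n2 \<noteq> R' mod n2"
      using R(3) by (metis div_mult_mod_eq)
    moreover note div_mod_less[OF R(1)] div_mod_less[OF R(2)]
    ultimately show ?thesis
      unfolding B1_def B2_def B3_def coincidences_mixed_radix[OF F1 F2 R(1,2)]
        t3.coincidences_translates_left[OF R(1,2)] t4.coincidences_translates_right[OF R(1,2)]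
      using coinc by (auto simp: constant_coincidence_cases mult_ac)
  qed

  show ?thesis
  proof (intro conjI impI design no_alias)
    let ?S = "{l2 * m1 + r3 * m3 + l4 * r4 * q4, l1 * l2 + r3 * m3 + r4 * m4,
      l1 * m2 + l3 * r3 * q3 + r4 * m4}"
    assume close: "\<forall>x\<in>?S. \<forall>y\<in>?S. \<bar>int x - int y\<bar> \<le> 1"
    show "E_f_NOD_optimal (n1 * n2) qs F"
    proof (rule E_f_NOD_optimalI[OF design pos])
      fix R R' assume "R < n1 * n2" "R' < n1 * n2" "R \<noteq> R'"
      then obtain x where x: "x \<in> ?S" "weighted_coincidence (\<lambda>_. 1) F R R' = real x"
        using wc[of R R' "\<lambda>_. 1"] by fastforce
      \<comment> \<open>The smallest of the three values serves as \<open>t\<close>: the others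
        exceed it by at most one.\<close>
      have "Min ?S \<in> ?S" by (rule Min_in) auto
      then have "\<bar>int x - int (Min ?S)\<bar> \<le> 1" using close x(1) by blast
      moreover have "Min ?S \<le> x" using x(1) by (intro Min_le) auto
      ultimately have "x = Min ?S \<or> x = Min ?S + 1" by linarith
      then show "weighted_coincidence (\<lambda>_. 1) F R R' \<in> {real (Min ?S), real (Min ?S) + 1}"
        using x(2) by auto
    qed
  next
    assume eq: "q1 * q2 * l2 * m1 + q3 * r3 * m3 + l4 * r4 * q4\<^sup>2
        = q1 * q2 * l1 * l2 + q3 * r3 * m3 + q4 * r4 * m4 \<and>
      q1 * q2 * l1 * l2 + q3 * r3 * m3 + q4 * r4 * m4
        = q1 * q2 * l1 * m2 + l3 * r3 * q3\<^sup>2 + q4 * r4 * m4"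
    show "chi_squared_optimal (n1 * n2) qs F"
    proof (rule chi_squared_optimalI[OF design pos])
      fix R R' assume "R < n1 * n2" "R' < n1 * n2" "R \<noteq> R'"
      then obtain x where x: "x \<in> {(l2 * m1, r3 * m3, l4 * r4 * q4), (l1 * l2, r3 * m3, r4 * m4),
          (l1 * m2, l3 * r3 * q3, r4 * m4)}"
        "weighted_coincidence (\<lambda>j. real (qs ! j)) F R R' =
          real (q1 * q2 * fst x + q3 * fst (snd x) + q4 * snd (snd x))"
        using wc[of R R' real] by fastforce
      \<comment> \<open>Weighting the blocks by their numbers of levels turns the three triples into
        the three sides of the hypothesis; the middle one is taken as the common value.\<close>
      have "q1 * q2 * fst x + q3 * fst (snd x) + q4 * snd (snd x) =
          q1 * q2 * l1 * l2 + q3 * r3 * m3 + q4 * r4 * m4"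
        using x(1) eq by (auto simp: power2_eq_square mult_ac)
      then show "weighted_coincidence (\<lambda>j. real (qs ! j)) F R R' =
          real (q1 * q2 * l1 * l2 + q3 * r3 * m3 + q4 * r4 * m4)"
        using x(2) by simp
    qed
  qed
qed

end
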